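(* Assume that the noise bound $\|y^\delta-y\|_{\mathcal Y}\le\delta$ and the conditional stability estimate (both as described in the context) hold. For $n\ge0$ set $\alpha_n=2^{-n}$ and choose $x_{\alpha_n}^\delta\in\mathcal X(\alpha_n;y^\delta)$; based on this sequence, define $$n^*=\inf\{n\ge0:\ \|F(x_{\alpha_n}^\delta)-y^\delta\|_{\mathcal Y}\le4\delta\}.$$ Assume that $x^\dagger\in\mathcal D(F)\cap\mathcal X_u$ for some $-a\le s\le u\le 2s+a$. Then for any $x_\alpha^\delta\in\mathcal X(\alpha_{n^*};y^\delta)$ one has $$\|x_\alpha^\delta-x^\dagger\|_{\mathcal X_r}\le C_5\,\delta^{\gamma\frac{u-r}{u+a}}\qquad\text{for all }-a\le r\le s,$$ with a constant $C_5$ depending only on $\|x^\dagger\|_{\mathcal X_u}$. Moreover, $\|F(x_\alpha^\delta)-y^\delta\|_{\mathcal Y}\le4\delta$.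
   Context: $\mathcal X,\mathcal Y$ are Hilbert spaces and $F:\mathcal D(F)\subset\mathcal X\to\mathcal Y$ is a nonlinear operator; no properties of $F$ and $\mathcal D(F)$ are required apart from the conditional stability estimate below ($F$ may be non-differentiable or even discontinuous). $\{\mathcal X_t\}_{t\in\mathbb R}$ is the Hilbert scale generated by a densely defined injective self-adjoint linear operator $L:\mathcal D(L)\subset\mathcal X\to\mathcal X$ with compact inverse; the elements of $\mathcal X_t$ have finite norm $\|x\|_{\mathcal X_t}=\|L^tx\|_{\mathcal X}$. Exact data: $y=F(x^\dagger)$ with $x^\dagger\in\mathcal D(F)$ the true solution. Noise bound: the noisy data $y^\delta\in\mathcal Y$ satisfy $\|y^\delta-y\|_{\mathcal Y}\le\delta$. Conditional stability estimate: there exist a function $R:\mathbb R_+\to\mathbb R_+$ and real numbers $a\ge0$ and $s,\gamma$ with $-a\le s$ and $0<\gamma\le1$ such that $$\|x_1-x_2\|_{\mathcal X_{-a}}\le R(\rho)\,\|F(x_1)-F(x_2)\|_{\mathcal Y}^\gamma\qquad\text{for all }x_1,x_2\in\mathcal M_\rho^s,$$ where $\mathcal M_\rho^s=\{x\in\mathcal D(F)\cap\mathcal X_s:\ \|x\|_{\mathcal X_s}\le\rho\}$. Tikhonov functional: $T(x;\alpha,y^\delta)=\|F(x)-y^\delta\|_{\mathcal Y}^2+\alpha\|x\|_{\mathcal X_s}^2$. Set of approximate minimizers: $$\mathcal X(\alpha;y^\delta)=\{x\in\mathcal D(F):\ T(x;\alpha,y^\delta)\le\inf_{z\in\mathcal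 D(F)}T(z;\alpha,y^\delta)+\delta^2\}.$$
   Formalization: The error bound is for elements of X(α_{n*};y^δ) with residual ≤4δ, the residual bound for the selected element only (both fail for arbitrary elements); δ ≤ δ_max for an arbitrary fixed δ_max on which C_5 may depend; for δ=0 the set defining n* is assumed nonempty. *)

theory Defs
  imports "HOL-Analysis.Analysis"
begin

text \<open>
  An unbounded operator is given by its domain \<open>DL\<close> and a total function \<open>L\<close> that matters
  only on \<open>DL\<close>.  Hilbert spaces are types of sort \<open>{real_inner, complete_space}\<close>; a complex
  Hilbert space is one of these under the real part of its inner product.
\<close>

definition adjoint_graph :: "'a::real_inner set \<Rightarrow> ('a \<Rightarrow> 'a) \<Rightarrow> ('a \<times> 'a) set" where
  "adjoint_graph DL L = {(v, w). \<forall>x\<in>DL. inner (L x) v = inner x w}"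

definition self_adjoint_on :: "'a::real_inner set \<Rightarrow> ('a \<Rightarrow> 'a) \<Rightarrow> bool" where
  "self_adjoint_on DL L \<longleftrightarrow> adjoint_graph DL L = {(v, L v) | v. v \<in> DL}"

definition linear_operator_on :: "'a::real_vector set \<Rightarrow> ('a \<Rightarrow> 'a) \<Rightarrow> bool" where
  "linear_operator_on DL L \<longleftrightarrow> subspace DL \<and>
     (\<forall>x\<in>DL. \<forall>y\<in>DL. L (x + y) = L x + L y) \<and>
     (\<forall>c. \<forall>x\<in>DL. L (c *\<^sub>R x) = c *\<^sub>R L x)"

definition compact_operator :: "('a::real_normed_vector \<Rightarrow> 'b::real_normed_vector) \<Rightarrow> bool" where
  "compact_operator K \<longleftrightarrow> linear K \<and> compact (closure (K ` cball 0 1))"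

definition scale_generator :: "'a::{real_inner,complete_space} set \<Rightarrow> ('a \<Rightarrow> 'a) \<Rightarrow> bool" where
  "scale_generator DL L \<longleftrightarrow>
     linear_operator_on DL L \<and> closure DL = UNIV \<and> self_adjoint_on DL L \<and>
     bij_betw L DL UNIV \<and> compact_operator (inv_into DL L)"

definition eigenspace :: "'a::real_vector set \<Rightarrow> ('a \<Rightarrow> 'a) \<Rightarrow> real \<Rightarrow> 'a set" where
  "eigenspace DL L l = {x \<in> DL. L x = l *\<^sub>R x}"

definition eigenvalues :: "'a::real_vector set \<Rightarrow> ('a \<Rightarrow> 'a) \<Rightarrow> real set" where
  "eigenvalues DL L = {l. \<exists>x \<in> eigenspace DL L l. x \<noteq> 0}"

definition orth_proj :: "'a::real_inner set \<Rightarrow> 'a \<Rightarrow> 'a" where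
  "orth_proj S x = (THE p. p \<in> S \<and> (\<forall>v\<in>S. inner (x - p) v = 0))"

text \<open>
  Functional calculus: since \<open>L\<close> has a compact inverse, its spectrum consists of eigenvalues, and
  \<open>L\<^sup>t x\<close> is the (unordered, norm convergent) sum of \<open>\<bar>l\<bar>\<^sup>t P\<^sub>l x\<close> over the eigenvalues \<open>l\<close>, where
  \<open>P\<^sub>l\<close> is the orthogonal projection onto the eigenspace of \<open>l\<close>.  For positive \<open>L\<close> the absolute
  value is redundant; for indefinite \<open>L\<close> it does not affect the norm of \<open>L\<^sup>t x\<close>.

  \<open>scale_space DL L t\<close> is the domain of \<open>L\<^sup>t\<close>.  For \<open>t \<ge> 0\<close> it is the space of order \<open>t\<close> of the
  Hilbert scale; for \<open>t < 0\<close>, where that space is a completion, it is its intersection with the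
  base space, i.e. the whole base space.  Outside \<open>scale_space DL L t\<close> the value of
  \<open>scale_norm DL L t\<close> is meaningless.
\<close>

definition scale_space :: "'a::{real_inner,complete_space} set \<Rightarrow> ('a \<Rightarrow> 'a) \<Rightarrow> real \<Rightarrow> 'a set" where
  "scale_space DL L t =
     {x. (\<lambda>l. \<bar>l\<bar> powr t *\<^sub>R orth_proj (eigenspace DL L l) x) summable_on eigenvalues DL L}"

definition scale_power ::
    "'a::{real_inner,complete_space} set \<Rightarrow> ('a \<Rightarrow> 'a) \<Rightarrow> real \<Rightarrow> 'a \<Rightarrow> 'a" where
  "scale_power DL L t x =
     (\<Sum>\<^sub>\<infinity>l\<in>eigenvalues DL L. \<bar>l\<bar> powr t *\<^sub>R orth_proj (eigenspace DL L l) x)"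

definition scale_norm ::
    "'a::{real_inner,complete_space} set \<Rightarrow> ('a \<Rightarrow> 'a) \<Rightarrow> real \<Rightarrow> 'a \<Rightarrow> real" where
  "scale_norm DL L t x = norm (scale_power DL L t x)"

definition stability_set ::
    "'a::{real_inner,complete_space} set \<Rightarrow> ('a \<Rightarrow> 'a) \<Rightarrow> real \<Rightarrow> 'a set \<Rightarrow> real \<Rightarrow> 'a set" where
  "stability_set DL L s DF \<rho> = {x \<in> DF \<inter> scale_space DL L s. scale_norm DL L s x \<le> \<rho>}"

definition conditional_stability ::
    "'a::{real_inner,complete_space} set \<Rightarrow> ('a \<Rightarrow> 'a) \<Rightarrow> real \<Rightarrow> real \<Rightarrow> real \<Rightarrow> (real \<Rightarrow> real) \<Rightarrow>
     'a set \<Rightarrow> ('a \<Rightarrow> 'b::{real_inner,complete_space}) \<Rightarrow> bool" where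
  "conditional_stability DL L a s \<gamma> R DF F \<longleftrightarrow>
     (\<forall>\<rho>\<ge>0. \<forall>x1 \<in> stability_set DL L s DF \<rho>. \<forall>x2 \<in> stability_set DL L s DF \<rho>.
        scale_norm DL L (- a) (x1 - x2) \<le> R \<rho> * norm (F x1 - F x2) powr \<gamma>)"

text \<open>The Tikhonov functional is infinite where the penalty is, i.e. outside the space of order \<open>s\<close>.\<close>

definition tikhonov ::
    "'a::{real_inner,complete_space} set \<Rightarrow> ('a \<Rightarrow> 'a) \<Rightarrow> real \<Rightarrow>
     ('a \<Rightarrow> 'b::{real_inner,complete_space}) \<Rightarrow> real \<Rightarrow> 'b \<Rightarrow> 'a \<Rightarrow> ennreal" where
  "tikhonov DL L s F \<alpha> yd x =
     (if x \<in> scale_space DL L s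
      then ennreal ((norm (F x - yd))\<^sup>2 + \<alpha> * (scale_norm DL L s x)\<^sup>2) else top)"

definition approx_minimizers ::
    "'a::{real_inner,complete_space} set \<Rightarrow> ('a \<Rightarrow> 'a) \<Rightarrow> real \<Rightarrow> 'a set \<Rightarrow>
     ('a \<Rightarrow> 'b::{real_inner,complete_space}) \<Rightarrow> real \<Rightarrow> real \<Rightarrow> 'b \<Rightarrow> 'a set" where
  "approx_minimizers DL L s DF F \<delta> \<alpha> yd =
     {x \<in> DF. tikhonov DL L s F \<alpha> yd x \<le>
        (INF z\<in>DF. tikhonov DL L s F \<alpha> yd z) + ennreal (\<delta>\<^sup>2)}"

definition reg_param :: "nat \<Rightarrow> real" where
  "reg_param n = 2 powr (- real n)"

text \<open>An infimum of natural numbers: the least element of the set, provided it is nonempty.\<close>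

definition stopping_index ::
    "('a \<Rightarrow> 'b::real_normed_vector) \<Rightarrow> real \<Rightarrow> 'b \<Rightarrow> (nat \<Rightarrow> 'a) \<Rightarrow> nat" where
  "stopping_index F \<delta> yd xs = Inf {n. norm (F (xs n) - yd) \<le> 4 * \<delta>}"

end

theory Submission
  imports Defs
begin

text \<open>
  Write \<open>e = x - x\<^sup>\<dagger>\<close>, \<open>A\<close> and \<open>E\<close> for its norms of orders \<open>-a\<close> and \<open>s\<close>, and \<open>d\<close> for the discrepancy.
  Comparing the Tikhonov functional at \<open>x\<close> and \<open>x\<^sup>\<dagger>\<close> gives \<open>d\<^sup>2 + \<alpha> E\<^sup>2 \<le> 2 \<delta>\<^sup>2 + 2 \<alpha> \<langle>e, x\<^sup>\<dagger>\<rangle>\<^sub>s\<close> up to sign.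
  By duality the pairing is at most the norm of \<open>e\<close> of order \<open>2 s - u\<close> times that of \<open>x\<^sup>\<dagger>\<close> of order
  \<open>u\<close>, and the former interpolates between \<open>A\<close> and \<open>E\<close>, where \<open>A\<close> is controlled by the conditional
  stability estimate.  At the last rejected parameter \<open>d > 4 \<delta>\<close>, so the term \<open>2 \<delta>\<^sup>2\<close> is absorbed and
  the inequality shows that \<open>\<delta>\<^sup>2 / \<alpha>\<close> is at most a constant times \<open>\<delta>\<close> to the power
  \<open>2 \<gamma> (u - s) / (u + a)\<close>.  At the accepted parameter \<open>d \<le> 4 \<delta>\<close>, so \<open>A\<close> is of order \<open>\<delta>\<^sup>\<gamma>\<close>, and the
  same inequality bounds \<open>E\<close>; interpolation gives the rate for all orders in between.
\<close>

subsection \<open>Projections and orthogonal series in Hilbert spaces\<close>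

text \<open>A minimizing sequence for the distance to \<open>S\<close> is Cauchy by the
  parallelogram identity; its limit attains the distance, and minimality along every line through it
  gives orthogonality.\<close>

lemma orth_proj_exists:
  fixes S :: "'a::{real_inner,complete_space} set"
  assumes S: "subspace S" "closed S"
  shows "\<exists>p\<in>S. \<forall>v\<in>S. inner (x - p) v = 0"
proof -
  define d where "d = (INF p\<in>S. (norm (x - p))\<^sup>2)"
  have bdd: "bdd_below ((\<lambda>p. (norm (x - p))\<^sup>2) ` S)"
    by (rule bdd_belowI2[of _ 0]) simp
  have d_le: "d \<le> (norm (x - p))\<^sup>2" if "p \<in> S" for p
    unfolding d_def using that by (intro cINF_lower bdd)
  have "\<exists>p\<in>S. (norm (x - p))\<^sup>2 < d + inverse (real (Suc n))" for n
  proof -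
    have "S \<noteq> {}"
      using subspace_0[OF S(1)] by auto
    then show ?thesis
      using cINF_less_iff[OF _ bdd, of "d + inverse (real (Suc n))"] unfolding d_def by simp
  qed
  then obtain p where p: "\<And>n. p n \<in> S" "\<And>n. (norm (x - p n))\<^sup>2 < d + inverse (real (Suc n))"
    by metis
  have close: "(norm (p m - p n))\<^sup>2 \<le> 2 * inverse (real (Suc m)) + 2 * inverse (real (Suc n))" for m n
  proof -
    have mid: "(1/2) *\<^sub>R (p m + p n) \<in> S"
      using S(1) p(1) by (simp add: subspace_add subspace_scale)
    have "(norm (p m - p n))\<^sup>2 =
        2 * (norm (x - p m))\<^sup>2 + 2 * (norm (x - p n))\<^sup>2 - 4 * (norm (x - (1/2) *\<^sub>R (p m + p n)))\<^sup>2"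
      by (simp add: power2_norm_eq_inner inner_diff inner_add inner_commute algebra_simps)
    then show ?thesis
      using d_le[OF mid] p(2)[of m] p(2)[of n] by linarith
  qed
  have "Cauchy p"
  proof (rule metric_CauchyI)
    fix e :: real assume "e > 0"
    then obtain N where N: "inverse (real (Suc N)) < e\<^sup>2 / 4"
      using reals_Archimedean[of "e\<^sup>2 / 4"] by auto
    have "dist (p m) (p n) < e" if mn: "m \<ge> N" "n \<ge> N" for m n
    proof -
      have "inverse (real (Suc m)) \<le> inverse (real (Suc N))" "inverse (real (Suc n)) \<le> inverse (real (Suc N))"
        using mn by (auto intro!: le_imp_inverse_le)
      then have "(norm (p m - p n))\<^sup>2 < e\<^sup>2"
        using close[of m n] N by linarith
      then show ?thesis
        using \<open>e > 0\<close> by (simp add: dist_norm power_less_imp_less_base)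
    qed
    then show "\<exists>M. \<forall>m\<ge>M. \<forall>n\<ge>M. dist (p m) (p n) < e"
      by blast
  qed
  then obtain q where q: "p \<longlonglongrightarrow> q"
    using Cauchy_convergent convergent_def by blast
  have qS: "q \<in> S"
    using closed_sequentially[OF S(2)] p(1) q by blast
  have "(\<lambda>n. (norm (x - p n))\<^sup>2) \<longlonglongrightarrow> (norm (x - q))\<^sup>2"
    by (intro tendsto_intros q)
  moreover have "(\<lambda>n. d + inverse (real (Suc n))) \<longlonglongrightarrow> d + 0"
    by (intro tendsto_intros LIMSEQ_inverse_real_of_nat)
  ultimately have "(norm (x - q))\<^sup>2 \<le> d + 0"
    using p(2) by (intro LIMSEQ_le) (auto intro!: exI[of _ 0] less_imp_le)
  then have q_le: "(norm (x - q))\<^sup>2 \<le> (norm (x - v))\<^sup>2" if "v \<in> S" for v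
    using d_le[OF that] by linarith
  have "inner (x - q) v = 0" if "v \<in> S" for v
  proof (cases "v = 0")
    case False
    \<comment> \<open>The optimal step length along \<open>v\<close>: there the quadratic drops by
      \<open>(inner (x - q) v)\<^sup>2 / inner v v\<close>, which minimality forces to
      vanish.\<close>
    define t where "t = inner (x - q) v / inner v v"
    have "(norm (x - q))\<^sup>2 \<le> (norm (x - (q + t *\<^sub>R v)))\<^sup>2"
      using S(1) qS that by (intro q_le) (simp add: subspace_add subspace_scale)
    also have "\<dots> = (norm ((x - q) - t *\<^sub>R v))\<^sup>2"
      by (simp add: algebra_simps)
    also have "\<dots> = (norm (x - q))\<^sup>2 - 2 * t * inner (x - q) v + t * (t * inner v v)"
      by (simp only: power2_norm_eq_inner) (simp add: inner_diff_left inner_diff_right inner_commute algebra_simps)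
    also have "t * inner v v = inner (x - q) v"
      using False by (simp add: t_def)
    finally have "(inner (x - q) v)\<^sup>2 / inner v v \<le> 0"
      by (simp add: t_def power2_eq_square)
    then have "(inner (x - q) v)\<^sup>2 \<le> 0"
      using False pos_divide_le_eq[of "inner v v" _ 0] by (metis inner_gt_zero_iff mult_zero_left)
    then show ?thesis by simp
  qed simp
  with qS show ?thesis by blast
qed

lemma orth_proj_eqI:
  assumes "subspace S" "p \<in> S" "\<And>v. v \<in> S \<Longrightarrow> inner (x - p) v = 0"
  shows "orth_proj S x = p"
  unfolding orth_proj_def
proof (rule the_equality)
  fix q assume q: "q \<in> S \<and> (\<forall>v\<in>S. inner (x - q) v = 0)"
  have "q - p \<in> S"
    using assms q by (simp add: subspace_diff)
  then have "inner (x - p) (q - p) - inner (x - q) (q - p) = 0"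
    using assms(3) q by simp
  then have "inner (q - p) (q - p) = 0"
    by (simp flip: inner_diff_left)
  then show "q = p" by simp
qed (use assms in auto)

lemma
  fixes S :: "'a::{real_inner,complete_space} set"
  assumes S: "subspace S" "closed S"
  shows orth_proj_in: "orth_proj S x \<in> S"
    and orth_proj_orthogonal: "v \<in> S \<Longrightarrow> inner (x - orth_proj S x) v = 0"
    and orth_proj_diff: "orth_proj S (x - z) = orth_proj S x - orth_proj S z"
proof -
  have *: "orth_proj S x \<in> S \<and> (\<forall>v\<in>S. inner (x - orth_proj S x) v = 0)" for x
    using orth_proj_exists[OF S, of x] orth_proj_eqI[OF S(1)] by metis
  show "orth_proj S x \<in> S" "v \<in> S \<Longrightarrow> inner (x - orth_proj S x) v = 0"
    using * by auto
  show "orth_proj S (x - z) = orth_proj S x - orth_proj S z"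
  proof (rule orth_proj_eqI[OF S(1)])
    show "orth_proj S x - orth_proj S z \<in> S"
      using * S(1) by (simp add: subspace_diff)
    fix v assume "v \<in> S"
    then have "inner (x - orth_proj S x) v = 0" "inner (z - orth_proj S z) v = 0"
      using * by auto
    then show "inner (x - z - (orth_proj S x - orth_proj S z)) v = 0"
      by (simp add: inner_diff_left)
  qed
qed

text \<open>By Pythagoras, multipliers bounded by \<open>C\<close> enlarge the norm of a finite
  partial sum at most by the factor \<open>C\<close>, so the Cauchy property of the net of partial
  sums passes from \<open>f\<close> to \<open>g\<close>. Orthogonal series need not converge
  absolutely, so comparing norms termwise would not suffice.\<close>

lemma summable_on_orthogonal_comparison:
  fixes f g :: "'i \<Rightarrow> 'a::{real_inner,complete_space}"
  assumes f: "f summable_on A"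
    and orth: "pairwise (\<lambda>i j. orthogonal (f i) (f j)) A"
    and g: "\<And>i. i \<in> A \<Longrightarrow> g i = c i *\<^sub>R f i" "\<And>i. i \<in> A \<Longrightarrow> \<bar>c i\<bar> \<le> C"
  shows "g summable_on A"
proof (cases "A = {}")
  case False
  have C: "C \<ge> 0"
    using False g(2) by (meson abs_ge_zero all_not_in_conv order_trans)
  from f obtain l where l: "(sum f \<longlongrightarrow> l) (finite_subsets_at_top A)"
    unfolding has_sum_def summable_on_def by blast
  have norm_le: "norm (sum g B) \<le> C * norm (sum f B)" if B: "finite B" "B \<subseteq> A" for B
  proof (rule power2_le_imp_le)
    have of: "pairwise (\<lambda>i j. orthogonal (f i) (f j)) B"
      using orth B(2) by (rule pairwise_subset)
    then have og: "pairwise (\<lambda>i j. orthogonal (g i) (g j)) B"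
      using B(2) g(1) by (auto simp: pairwise_def orthogonal_def subset_iff)
    have "(norm (sum g B))\<^sup>2 = (\<Sum>i\<in>B. (norm (g i))\<^sup>2)"
      by (rule norm_sum_Pythagorean[OF B(1) og])
    also have "\<dots> \<le> (\<Sum>i\<in>B. C\<^sup>2 * (norm (f i))\<^sup>2)"
    proof (rule sum_mono)
      fix i assume "i \<in> B"
      then have "i \<in> A" using B(2) by auto
      then have "norm (g i) \<le> C * norm (f i)"
        using g by (simp add: mult_right_mono)
      then show "(norm (g i))\<^sup>2 \<le> C\<^sup>2 * (norm (f i))\<^sup>2"
        by (metis norm_ge_zero power_mono power_mult_distrib)
    qed
    also have "\<dots> = (C * norm (sum f B))\<^sup>2"
      by (simp add: norm_sum_Pythagorean[OF B(1) of] power_mult_distrib sum_distrib_left)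
    finally show "(norm (sum g B))\<^sup>2 \<le> (C * norm (sum f B))\<^sup>2" .
  qed (use C in simp)
  have "\<exists>P. eventually P (finite_subsets_at_top A) \<and>
      (\<forall>F F'. P F \<and> P F' \<longrightarrow> dist (sum g F) (sum g F') < e)" if "e > 0" for e
  proof -
    define d where "d = e / (4 * C + 4)"
    have d: "d > 0" "4 * (C * d) < e"
      using that C by (auto simp: d_def field_simps)
    have "\<forall>\<^sub>F F in finite_subsets_at_top A. dist (sum f F) l < d"
      using l d(1) by (rule tendstoD)
    then obtain F0 where F0: "finite F0" "F0 \<subseteq> A"
      "\<And>F. finite F \<Longrightarrow> F0 \<subseteq> F \<Longrightarrow> F \<subseteq> A \<Longrightarrow> dist (sum f F) l < d"
      unfolding eventually_finite_subsets_at_top by (elim exE conjE) simp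
    define P where "P = (\<lambda>F. finite F \<and> F0 \<subseteq> F \<and> F \<subseteq> A)"
    have "eventually P (finite_subsets_at_top A)"
      unfolding eventually_finite_subsets_at_top P_def using F0(1,2) by (intro exI[of _ F0]) simp
    moreover have "dist (sum g F1) (sum g F2) < e" if P: "P F1" "P F2" for F1 F2
    proof -
      \<comment> \<open>Both partial sums are compared with the one over
        \<open>F1 \<union> F2\<close>, so that each difference is again a finite partial sum, to
        which \<open>norm_le\<close> applies.\<close>
      have step: "dist (sum g (F1 \<union> F2)) (sum g F) \<le> C * (2 * d)" if F: "F = F1 \<or> F = F2" for F
      proof -
        have fin: "finite (F1 \<union> F2)" "F \<subseteq> F1 \<union> F2" "F1 \<union> F2 \<subseteq> A" "F0 \<subseteq> F" "finite F"
          using P F by (auto simp: P_def)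
        have "dist (sum g (F1 \<union> F2)) (sum g F) = norm (sum g (F1 \<union> F2 - F))"
          unfolding dist_norm using fin by (subst sum_diff) auto
        also have "\<dots> \<le> C * norm (sum f (F1 \<union> F2 - F))"
          using fin by (intro norm_le) auto
        also have "norm (sum f (F1 \<union> F2 - F)) = dist (sum f (F1 \<union> F2)) (sum f F)"
          unfolding dist_norm using fin by (subst sum_diff) auto
        also have "\<dots> \<le> dist (sum f (F1 \<union> F2)) l + dist (sum f F) l"
          by (rule dist_triangle2)
        also have "\<dots> \<le> 2 * d"
          using F0(3)[of "F1 \<union> F2"] F0(3)[of F] fin by fastforce
        finally show ?thesis
          using C by (simp add: mult_left_mono)
      qed
      have "dist (sum g F1) (sum g F2) \<le> dist (sum g (F1 \<union> F2)) (sum g F1) + dist (sum g (F1 \<union> F2)) (sum g F2)"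
        by (rule dist_triangle3)
      then show ?thesis
        using step[of F1] step[of F2] d(2) by simp
    qed
    ultimately show ?thesis by blast
  qed
  then have "cauchy_filter (filtermap (sum g) (finite_subsets_at_top A))"
    by (simp add: cauchy_filter_metric_filtermap)
  moreover have "complete (UNIV :: 'a set)"
    by (meson Cauchy_convergent UNIV_I complete_def convergent_def)
  ultimately obtain l' where "(sum g \<longlongrightarrow> l') (finite_subsets_at_top A)"
    using complete_uniform[where S=UNIV] by (force simp add: filterlim_def)
  then show ?thesis
    using summable_on_def has_sum_def by blast
qed simp

text \<open>Continuity is used in one argument at a time: pairing \<open>f i\<close> with all of
  \<open>T\<close> leaves the diagonal term, and summing over \<open>i\<close> then yields the
  pairing with \<open>S\<close>.\<close>

lemma has_sum_inner_orthogonal: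
  fixes f g :: "'i \<Rightarrow> 'a::real_inner"
  assumes f: "(f has_sum S) A" and g: "(g has_sum T) A"
    and orth: "\<And>i j. i \<in> A \<Longrightarrow> j \<in> A \<Longrightarrow> i \<noteq> j \<Longrightarrow> inner (f i) (g j) = 0"
  shows "((\<lambda>i. inner (f i) (g i)) has_sum inner S T) A"
proof -
  have "inner (f i) T = inner (f i) (g i)" if "i \<in> A" for i
  proof (rule has_sum_unique)
    show "((\<lambda>j. inner (f i) (g j)) has_sum inner (f i) T) A"
      by (rule has_sum_bounded_linear[OF bounded_linear_inner_right g])
    have "((\<lambda>j. inner (f i) (g j)) has_sum inner (f i) (g i)) {i}"
      by (rule has_sum_finiteI) auto
    then show "((\<lambda>j. inner (f i) (g j)) has_sum inner (f i) (g i)) A"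
      by (rule iffD1[OF has_sum_cong_neutral, rotated -1]) (use orth that in auto)
  qed
  moreover have "((\<lambda>i. inner (f i) T) has_sum inner S T) A"
    by (rule has_sum_bounded_linear[OF bounded_linear_inner_left f])
  ultimately show ?thesis
    by (simp cong: has_sum_cong)
qed

text \<open>Hoelder's inequality with exponents \<open>1/\<lambda>\<close> and \<open>1/(1-\<lambda>)\<close>, by Young's inequality after normalising both sums.\<close>

lemma has_sum_powr_interpolation:
  fixes f g :: "'i \<Rightarrow> real"
  assumes f: "(f has_sum A) I" "\<And>i. i \<in> I \<Longrightarrow> 0 \<le> f i"
    and g: "(g has_sum B) I" "\<And>i. i \<in> I \<Longrightarrow> 0 \<le> g i"
    and h: "(h has_sum C) I" "\<And>i. i \<in> I \<Longrightarrow> h i \<le> f i powr \<mu> * g i powr (1 - \<mu>)"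
    and mu: "0 \<le> \<mu>" "\<mu> \<le> 1"
  shows "C \<le> A powr \<mu> * B powr (1 - \<mu>)"
proof (cases "A > 0 \<and> B > 0")
  case True
  have "h i \<le> (A powr \<mu> * B powr (1 - \<mu>)) * (\<mu> / A * f i + (1 - \<mu>) / B * g i)" if i: "i \<in> I" for i
  proof (cases "f i > 0 \<and> g i > 0")
    case pos: True
    have "(f i / A) powr \<mu> * (g i / B) powr (1 - \<mu>) \<le> \<mu> * (f i / A) + (1 - \<mu>) * (g i / B)"
      using True pos mu by (intro Youngs_inequality_0) auto
    then have "(A powr \<mu> * B powr (1 - \<mu>)) * ((f i / A) powr \<mu> * (g i / B) powr (1 - \<mu>))
        \<le> (A powr \<mu> * B powr (1 - \<mu>)) * (\<mu> / A * f i + (1 - \<mu>) / B * g i)"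
      by (intro mult_left_mono) auto
    moreover have "(A powr \<mu> * B powr (1 - \<mu>)) * ((f i / A) powr \<mu> * (g i / B) powr (1 - \<mu>))
        = f i powr \<mu> * g i powr (1 - \<mu>)"
      using True pos by (simp add: powr_divide)
    ultimately show ?thesis
      using h(2)[OF i] by linarith
  next
    case False
    \<comment> \<open>A vanishing factor makes the product zero for every exponent, because
      \<open>0 powr 0 = 0\<close>.\<close>
    then have "f i powr \<mu> * g i powr (1 - \<mu>) = 0"
      using f(2)[OF i] g(2)[OF i] by force
    moreover have "0 \<le> (A powr \<mu> * B powr (1 - \<mu>)) * (\<mu> / A * f i + (1 - \<mu>) / B * g i)"
      using f(2)[OF i] g(2)[OF i] True mu by simp
    ultimately show ?thesis
      using h(2)[OF i] by linarith
  qed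
  moreover have "((\<lambda>i. (A powr \<mu> * B powr (1 - \<mu>)) * (\<mu> / A * f i + (1 - \<mu>) / B * g i)) has_sum
      (A powr \<mu> * B powr (1 - \<mu>)) * (\<mu> / A * A + (1 - \<mu>) / B * B)) I"
    by (intro has_sum_cmult_right has_sum_add f g)
  ultimately have "C \<le> (A powr \<mu> * B powr (1 - \<mu>)) * (\<mu> / A * A + (1 - \<mu>) / B * B)"
    by (intro has_sum_mono[OF h(1)])
  then show ?thesis using True by simp
next
  case False
  have "A \<ge> 0" "B \<ge> 0"
    using f g by (auto intro: has_sum_nonneg)
  then have AB: "A = 0 \<or> B = 0"
    using False by auto
  \<comment> \<open>A zero sum of nonnegative terms has only zero terms, and
    \<open>0 powr 0 = 0\<close> again covers the extreme values of \<open>\<mu>\<close>.\<close>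
  have "h i \<le> 0" if "i \<in> I" for i
    using AB nonneg_has_sum_le_0D[OF f(1) _ f(2) that] nonneg_has_sum_le_0D[OF g(1) _ g(2) that] h(2)[OF that]
    by auto
  then have "C \<le> 0"
    by (rule has_sum_mono[OF h(1) has_sum_0_simp])
  then show ?thesis using AB by auto
qed

subsection \<open>Hilbert scales\<close>

locale hilbert_scale =
  fixes DL :: "'a::{real_inner,complete_space} set" and L :: "'a \<Rightarrow> 'a"
  assumes generator: "scale_generator DL L"
begin

section \<open>Spectral facts about the generator\<close>

lemma subspace_eigenspace: "subspace (eigenspace DL L l)"
proof -
  have lin: "linear_operator_on DL L"
    using generator by (simp add: scale_generator_def)
  then have DL: "subspace DL"
    by (simp add: linear_operator_on_def)
  have "L (0 *\<^sub>R 0) = 0 *\<^sub>R L 0"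
    using lin subspace_0[OF DL] unfolding linear_operator_on_def by blast
  then have "L 0 = 0" by simp
  then show ?thesis
    using lin DL unfolding linear_operator_on_def eigenspace_def subspace_def
    by (auto simp: scaleR_add_right)
qed

lemma inner_operator_commute:
  assumes "x \<in> DL" "z \<in> DL"
  shows "inner (L x) z = inner x (L z)"
proof -
  have "(z, L z) \<in> adjoint_graph DL L"
    using generator assms by (auto simp: scale_generator_def self_adjoint_on_def)
  then show ?thesis
    using assms by (simp add: adjoint_graph_def)
qed

text \<open>The operator may be unbounded, so continuity is not at hand; instead the relation
  defining the adjoint graph survives limits, and self-adjointness turns it back into the graph of
  \<open>L\<close>.\<close>

lemma closed_eigenspace: "closed (eigenspace DL L l)"
  unfolding closed_sequential_limits
proof (intro allI impI, elim conjE)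
  fix f x
  assume f: "\<forall>n. f n \<in> eigenspace DL L l" and lim: "f \<longlonglongrightarrow> x"
  have "inner (L v) x = inner v (l *\<^sub>R x)" if v: "v \<in> DL" for v
  proof (rule LIMSEQ_unique)
    show "(\<lambda>n. inner (L v) (f n)) \<longlonglongrightarrow> inner (L v) x"
      by (intro tendsto_intros lim)
    have "inner (L v) (f n) = inner v (l *\<^sub>R f n)" for n
      using inner_operator_commute[OF v, of "f n"] f by (simp add: eigenspace_def)
    moreover have "(\<lambda>n. inner v (l *\<^sub>R f n)) \<longlonglongrightarrow> inner v (l *\<^sub>R x)"
      by (intro tendsto_intros lim)
    ultimately show "(\<lambda>n. inner (L v) (f n)) \<longlonglongrightarrow> inner v (l *\<^sub>R x)"
      by simp
  qed
  then have "(x, l *\<^sub>R x) \<in> adjoint_graph DL L"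
    by (simp add: adjoint_graph_def)
  then show "x \<in> eigenspace DL L l"
    using generator by (auto simp: scale_generator_def self_adjoint_on_def eigenspace_def)
qed

lemma eigenspaces_orthogonal:
  assumes "x \<in> eigenspace DL L l" "z \<in> eigenspace DL L m" "l \<noteq> m"
  shows "inner x z = 0"
proof -
  have "l * inner x z = m * inner x z"
    using inner_operator_commute[of x z] assms(1,2) by (simp add: eigenspace_def)
  then show ?thesis using assms(3) by simp
qed

text \<open>The compact inverse is bounded, and an eigenvector satisfies
  \<open>x = K (l *\<^sub>R x)\<close>. This spectral gap bounds the powers of
  \<open>\<bar>l\<bar>\<close> with nonpositive exponent, on which all embeddings of the scale
  rest.\<close>

lemma eigenvalues_lower_bound: "\<exists>m>0. \<forall>l\<in>eigenvalues DL L. m \<le> \<bar>l\<bar>"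
proof -
  define K where "K = inv_into DL L"
  have bij: "bij_betw L DL UNIV" and K: "linear K" "compact (closure (K ` cball 0 1))"
    using generator by (auto simp: scale_generator_def compact_operator_def K_def)
  have "bounded (K ` cball 0 1)"
    using compact_imp_bounded[OF K(2)] closure_subset bounded_subset by blast
  then obtain B where B: "B > 0" "\<And>z. z \<in> cball 0 1 \<Longrightarrow> norm (K z) \<le> B"
    by (auto simp: bounded_pos)
  have "1 / B \<le> \<bar>l\<bar>" if l: "l \<in> eigenvalues DL L" for l
  proof -
    obtain x where x: "x \<in> DL" "L x = l *\<^sub>R x" "x \<noteq> 0"
      using l by (auto simp: eigenvalues_def eigenspace_def)
    have "x = K (l *\<^sub>R x)"
      using bij x(1,2) by (metis K_def bij_betw_inv_into_left)
    also have "\<dots> = (l * norm x) *\<^sub>R K (x /\<^sub>R norm x)"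
      using x(3) by (simp add: linear_cmul[OF K(1)])
    finally have "norm x = \<bar>l\<bar> * norm x * norm (K (x /\<^sub>R norm x))"
      by (metis abs_mult abs_norm_cancel norm_scaleR)
    also have "\<dots> \<le> \<bar>l\<bar> * norm x * B"
      using x(3) by (intro mult_left_mono B(2)) auto
    finally have "norm x * 1 \<le> norm x * (\<bar>l\<bar> * B)"
      by (simp add: mult_ac)
    then show ?thesis
      using x(3) B(1) by (simp add: field_simps)
  qed
  then show ?thesis
    using B(1) by (intro exI[of _ "1 / B"]) simp
qed

section \<open>Powers of the generator and their pairings\<close>

abbreviation component :: "real \<Rightarrow> 'a \<Rightarrow> 'a" where
  "component l x \<equiv> orth_proj (eigenspace DL L l) x"

lemma component_orthogonal: "l \<noteq> m \<Longrightarrow> inner (component l x) (component m z) = 0"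
  by (meson eigenspaces_orthogonal orth_proj_in subspace_eigenspace closed_eigenspace)

lemma component_diff: "component l (x - z) = component l x - component l z"
  by (rule orth_proj_diff[OF subspace_eigenspace closed_eigenspace])

lemma has_sum_scale_power:
  assumes "x \<in> scale_space DL L t"
  shows "((\<lambda>l. \<bar>l\<bar> powr t *\<^sub>R component l x) has_sum scale_power DL L t x) (eigenvalues DL L)"
  using assms unfolding scale_space_def scale_power_def by (simp add: summable_iff_has_sum_infsum)

lemma
  assumes "x \<in> scale_space DL L t" "z \<in> scale_space DL L t"
  shows scale_space_diff: "x - z \<in> scale_space DL L t"
    and scale_power_diff: "scale_power DL L t (x - z) = scale_power DL L t x - scale_power DL L t z"
proof -
  have "((\<lambda>l. \<bar>l\<bar> powr t *\<^sub>R component l x + - (\<bar>l\<bar> powr t *\<^sub>R component l z)) has_sum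
      scale_power DL L t x + - scale_power DL L t z) (eigenvalues DL L)"
    using assms by (intro has_sum_add has_sum_uminus[THEN iffD2]) (simp_all add: has_sum_scale_power)
  then have *: "((\<lambda>l. \<bar>l\<bar> powr t *\<^sub>R component l (x - z)) has_sum
      scale_power DL L t x - scale_power DL L t z) (eigenvalues DL L)"
    by (simp add: component_diff scaleR_diff_right)
  then show "x - z \<in> scale_space DL L t"
    unfolding scale_space_def summable_on_def by blast
  show "scale_power DL L t (x - z) = scale_power DL L t x - scale_power DL L t z"
    unfolding scale_power_def using infsumI[OF *] by (simp add: scale_power_def)
qed

text \<open>The two series differ by the factors \<open>\<bar>l\<bar> powr (r - t)\<close>, bounded
  through the spectral gap.\<close>

lemma scale_space_mono:
  assumes x: "x \<in> scale_space DL L t" and "r \<le> t"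
  shows "x \<in> scale_space DL L r"
proof -
  obtain m where m: "m > 0" "\<And>l. l \<in> eigenvalues DL L \<Longrightarrow> m \<le> \<bar>l\<bar>"
    using eigenvalues_lower_bound by blast
  have "(\<lambda>l. \<bar>l\<bar> powr r *\<^sub>R component l x) summable_on eigenvalues DL L"
  proof (rule summable_on_orthogonal_comparison)
    show "(\<lambda>l. \<bar>l\<bar> powr t *\<^sub>R component l x) summable_on eigenvalues DL L"
      using x by (simp add: scale_space_def)
    show "pairwise (\<lambda>i j. orthogonal (\<bar>i\<bar> powr t *\<^sub>R component i x) (\<bar>j\<bar> powr t *\<^sub>R component j x))
        (eigenvalues DL L)"
      by (simp add: pairwise_def orthogonal_def component_orthogonal)
    fix l assume l: "l \<in> eigenvalues DL L"
    show "\<bar>l\<bar> powr r *\<^sub>R component l x = \<bar>l\<bar> powr (r - t) *\<^sub>R \<bar>l\<bar> powr t *\<^sub>R component l x"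
      by (simp flip: powr_add)
    show "\<bar>\<bar>l\<bar> powr (r - t)\<bar> \<le> m powr (r - t)"
      using m l assms(2) by (simp add: powr_mono2')
  qed
  then show ?thesis by (simp add: scale_space_def)
qed

lemma has_sum_inner_scale_power:
  assumes "x \<in> scale_space DL L p" "z \<in> scale_space DL L q"
  shows "((\<lambda>l. \<bar>l\<bar> powr (p + q) * inner (component l x) (component l z)) has_sum
    inner (scale_power DL L p x) (scale_power DL L q z)) (eigenvalues DL L)"
proof -
  have "((\<lambda>l. inner (\<bar>l\<bar> powr p *\<^sub>R component l x) (\<bar>l\<bar> powr q *\<^sub>R component l z)) has_sum
      inner (scale_power DL L p x) (scale_power DL L q z)) (eigenvalues DL L)"
    by (intro has_sum_inner_orthogonal has_sum_scale_power assms) (simp add: component_orthogonal)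
  then show ?thesis
    by (simp add: powr_add mult_ac)
qed

text \<open>Both pairings sum the same series, whose weights see only \<open>p + q\<close>; this
  moves smoothness from one argument to the other.\<close>

lemma inner_scale_power_shift:
  assumes "x \<in> scale_space DL L p" "z \<in> scale_space DL L q"
    and "x \<in> scale_space DL L p'" "z \<in> scale_space DL L q'" and "p + q = p' + q'"
  shows "inner (scale_power DL L p x) (scale_power DL L q z) =
    inner (scale_power DL L p' x) (scale_power DL L q' z)"
  using has_sum_inner_scale_power[OF assms(1,2)] has_sum_inner_scale_power[OF assms(3,4)] assms(5)
  by (simp add: has_sum_unique)

section \<open>Scale norms: Parseval, embedding, interpolation\<close>

lemma has_sum_scale_norm:
  assumes "x \<in> scale_space DL L t"
  shows "((\<lambda>l. \<bar>l\<bar> powr (2 * t) * (norm (component l x))\<^sup>2) has_sum (scale_norm DL L t x)\<^sup>2)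
    (eigenvalues DL L)"
  using has_sum_inner_scale_power[OF assms assms] unfolding scale_norm_def power2_norm_eq_inner
  by simp

lemma scale_norm_nonneg [simp]: "0 \<le> scale_norm DL L t x"
  by (simp add: scale_norm_def)

text \<open>Parseval makes every weighted component vanish. This serves exact data, where stability
  alone gives a zero error of order \<open>- a\<close>.\<close>

lemma scale_norm_eq_0_transfer:
  assumes "x \<in> scale_space DL L p" "scale_norm DL L p x = 0"
  shows "scale_norm DL L q x = 0"
proof -
  have "\<bar>l\<bar> powr q *\<^sub>R component l x = 0" if "l \<in> eigenvalues DL L" for l
    using nonneg_has_sum_le_0D[OF has_sum_scale_norm[OF assms(1)] _ _ that] assms(2) by auto
  then have "scale_power DL L q x = 0"
    unfolding scale_power_def by (rule infsum_0)
  then show ?thesis by (simp add: scale_norm_def)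
qed

lemma scale_norm_embedding:
  assumes "s \<le> u"
  shows "\<exists>\<kappa>\<ge>0. \<forall>x\<in>scale_space DL L u. scale_norm DL L s x \<le> \<kappa> * scale_norm DL L u x"
proof -
  obtain m where m: "m > 0" "\<And>l. l \<in> eigenvalues DL L \<Longrightarrow> m \<le> \<bar>l\<bar>"
    using eigenvalues_lower_bound by blast
  have "scale_norm DL L s x \<le> m powr (s - u) * scale_norm DL L u x" if x: "x \<in> scale_space DL L u" for x
  proof (rule power2_le_imp_le)
    have "(scale_norm DL L s x)\<^sup>2 \<le> (m powr (s - u))\<^sup>2 * (scale_norm DL L u x)\<^sup>2"
    proof (rule has_sum_mono)
      show "((\<lambda>l. \<bar>l\<bar> powr (2 * s) * (norm (component l x))\<^sup>2) has_sum (scale_norm DL L s x)\<^sup>2)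
          (eigenvalues DL L)"
        by (intro has_sum_scale_norm scale_space_mono[OF x assms])
      show "((\<lambda>l. (m powr (s - u))\<^sup>2 * (\<bar>l\<bar> powr (2 * u) * (norm (component l x))\<^sup>2)) has_sum
          (m powr (s - u))\<^sup>2 * (scale_norm DL L u x)\<^sup>2) (eigenvalues DL L)"
        by (intro has_sum_cmult_right has_sum_scale_norm x)
      fix l assume l: "l \<in> eigenvalues DL L"
      have "\<bar>l\<bar> powr (2 * s) = (\<bar>l\<bar> powr (s - u))\<^sup>2 * \<bar>l\<bar> powr (2 * u)"
        by (simp add: power2_eq_square flip: powr_add)
      also have "\<dots> \<le> (m powr (s - u))\<^sup>2 * \<bar>l\<bar> powr (2 * u)"
        using m l assms by (intro mult_right_mono power_mono powr_mono2') auto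
      finally have "\<bar>l\<bar> powr (2 * s) * (norm (component l x))\<^sup>2 \<le>
          (m powr (s - u))\<^sup>2 * \<bar>l\<bar> powr (2 * u) * (norm (component l x))\<^sup>2"
        by (rule mult_right_mono) simp
      then show "\<bar>l\<bar> powr (2 * s) * (norm (component l x))\<^sup>2 \<le>
          (m powr (s - u))\<^sup>2 * (\<bar>l\<bar> powr (2 * u) * (norm (component l x))\<^sup>2)"
        by (simp add: mult_ac)
    qed
    then show "(scale_norm DL L s x)\<^sup>2 \<le> (m powr (s - u) * scale_norm DL L u x)\<^sup>2"
      by (simp add: power_mult_distrib)
  qed simp
  then show ?thesis
    by (intro exI[of _ "m powr (s - u)"]) simp
qed

text \<open>Hoelder's inequality for the Parseval series: the weight of order \<open>r\<close> is
  the geometric mean, with exponents \<open>\<mu>\<close> and \<open>1 - \<mu>\<close>, of those of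
  orders \<open>p\<close> and \<open>q\<close>.\<close>

lemma scale_norm_interpolation:
  assumes x: "x \<in> scale_space DL L p" "x \<in> scale_space DL L q" "x \<in> scale_space DL L r"
    and mu: "0 \<le> \<mu>" "\<mu> \<le> 1" and r: "r = \<mu> * p + (1 - \<mu>) * q"
  shows "scale_norm DL L r x \<le> scale_norm DL L p x powr \<mu> * scale_norm DL L q x powr (1 - \<mu>)"
proof (rule power2_le_imp_le)
  have "(scale_norm DL L r x)\<^sup>2 \<le>
      (scale_norm DL L p x)\<^sup>2 powr \<mu> * (scale_norm DL L q x)\<^sup>2 powr (1 - \<mu>)"
  proof (rule has_sum_powr_interpolation[OF has_sum_scale_norm[OF x(1)] _
        has_sum_scale_norm[OF x(2)] _ has_sum_scale_norm[OF x(3)] _ mu])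
    fix l assume l: "l \<in> eigenvalues DL L"
    define w where "w = (norm (component l x))\<^sup>2"
    have w: "w powr \<mu> * w powr (1 - \<mu>) = w"
      by (simp add: w_def flip: powr_add)
    have "\<bar>l\<bar> powr (2 * r) = (\<bar>l\<bar> powr (2 * p)) powr \<mu> * (\<bar>l\<bar> powr (2 * q)) powr (1 - \<mu>)"
      by (simp add: powr_powr r algebra_simps flip: powr_add)
    then have "\<bar>l\<bar> powr (2 * r) * w =
        (\<bar>l\<bar> powr (2 * p)) powr \<mu> * (\<bar>l\<bar> powr (2 * q)) powr (1 - \<mu>) * (w powr \<mu> * w powr (1 - \<mu>))"
      using w by simp
    also have "\<dots> = (\<bar>l\<bar> powr (2 * p) * w) powr \<mu> * (\<bar>l\<bar> powr (2 * q) * w) powr (1 - \<mu>)"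
      by (simp add: powr_mult w_def mult_ac)
    finally show "\<bar>l\<bar> powr (2 * r) * (norm (component l x))\<^sup>2 \<le>
        (\<bar>l\<bar> powr (2 * p) * (norm (component l x))\<^sup>2) powr \<mu> *
        (\<bar>l\<bar> powr (2 * q) * (norm (component l x))\<^sup>2) powr (1 - \<mu>)"
      by (simp add: w_def)
  qed auto
  then show "(scale_norm DL L r x)\<^sup>2 \<le>
      (scale_norm DL L p x powr \<mu> * scale_norm DL L q x powr (1 - \<mu>))\<^sup>2"
    by (simp add: power2_eq_square powr_mult mult_ac)
qed simp

text \<open>The cross term of the penalty, estimated in the duality pairing of the spaces of orders \<open>2 s - u\<close> and \<open>u\<close>.\<close>

lemma scale_norm_diff_le:
  assumes x: "x \<in> scale_space DL L s" and z: "z \<in> scale_space DL L u" and "s \<le> u"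
  shows "(scale_norm DL L s (x - z))\<^sup>2 \<le> (scale_norm DL L s x)\<^sup>2 - (scale_norm DL L s z)\<^sup>2
    + 2 * (scale_norm DL L (2 * s - u) (x - z) * scale_norm DL L u z)"
proof -
  have zs: "z \<in> scale_space DL L s"
    using scale_space_mono[OF z \<open>s \<le> u\<close>] .
  have d: "x - z \<in> scale_space DL L s"
    by (rule scale_space_diff[OF x zs])
  have d': "x - z \<in> scale_space DL L (2 * s - u)"
    using \<open>s \<le> u\<close> by (intro scale_space_mono[OF d]) simp
  let ?d = "scale_power DL L s (x - z)" and ?z = "scale_power DL L s z"
  have "(scale_norm DL L s x)\<^sup>2 = (norm (?d + ?z))\<^sup>2"
    by (simp add: scale_norm_def scale_power_diff[OF x zs])
  also have "\<dots> = (norm ?d)\<^sup>2 + (norm ?z)\<^sup>2 + 2 * inner ?d ?z"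
    by (simp add: power2_norm_eq_inner inner_add inner_commute)
  also have "inner ?d ?z = inner (scale_power DL L (2 * s - u) (x - z)) (scale_power DL L u z)"
    by (rule inner_scale_power_shift[OF d zs d' z]) simp
  finally show ?thesis
    using Cauchy_Schwarz_ineq2[of "scale_power DL L (2 * s - u) (x - z)" "scale_power DL L u z"]
    by (simp add: scale_norm_def)
qed

end

subsection \<open>The discrepancy principle\<close>

text \<open>Replacing \<open>c powr t\<close> by \<open>1 + c\<close> and
  \<open>C powr (1 - t)\<close> by \<open>C\<close> makes the constant independent of
  \<open>t\<close>, hence later of the order \<open>r\<close>. In the applications
  \<open>\<eta>\<close> is a residual bound raised to \<open>\<gamma>\<close>.\<close>

lemma powr_interpolation_bound:
  fixes A E c C p t \<eta> :: real
  assumes "0 \<le> A" "A \<le> c * \<eta>" "0 \<le> E" "E \<le> C * \<eta> powr p" "0 \<le> c" "1 \<le> C" "0 < \<eta>" "0 \<le> t" "t \<le> 1"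
  shows "A powr t * E powr (1 - t) \<le> (1 + c) * C * \<eta> powr (t + p * (1 - t))"
proof -
  have "c powr t \<le> (1 + c) powr t"
    using assms by (intro powr_mono2) auto
  also have "\<dots> \<le> (1 + c) powr 1"
    using assms by (intro powr_mono) auto
  finally have c: "c powr t \<le> 1 + c"
    using assms by simp
  have "C powr (1 - t) \<le> C powr 1"
    using assms by (intro powr_mono) auto
  then have C: "C powr (1 - t) \<le> C"
    using assms by simp
  have "A powr t * E powr (1 - t) \<le> (c * \<eta>) powr t * (C * \<eta> powr p) powr (1 - t)"
    using assms by (intro mult_mono powr_mono2) auto
  also have "\<dots> = (c powr t * C powr (1 - t)) * \<eta> powr (t + p * (1 - t))"
    using assms by (simp add: powr_mult powr_powr powr_add)
  also have "\<dots> \<le> (1 + c) * C * \<eta> powr (t + p * (1 - t))"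
    using assms by (intro mult_right_mono mult_mono c C) auto
  finally show ?thesis .
qed

text \<open>The exponent \<open>p\<close> solves
  \<open>\<theta> + p * (1 - \<theta>) = 2 * p\<close>, so after normalising \<open>E\<close> by
  \<open>\<eta> powr p\<close> all terms scale alike and a scalar inequality for
  \<open>\<epsilon>\<close> remains.\<close>

lemma quadratic_interpolation_bound:
  fixes A E G M c p \<theta> \<eta> :: real
  assumes "0 \<le> A" "A \<le> c * \<eta>" "0 \<le> E" "0 \<le> c" "0 < \<eta>" "0 \<le> \<theta>" "\<theta> \<le> 1" "0 \<le> G" "0 \<le> M"
    and p: "p = \<theta> / (1 + \<theta>)"
    and E: "E\<^sup>2 \<le> G * \<eta> powr (2 * p) + 2 * M * (A powr \<theta> * E powr (1 - \<theta>))"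
  shows "E \<le> (1 + G + 2 * M * (1 + c)) * \<eta> powr p"
proof -
  define \<epsilon> where "\<epsilon> = E / \<eta> powr p"
  have E_eq: "E = \<epsilon> * \<eta> powr p" and "0 \<le> \<epsilon>"
    using assms by (auto simp: \<epsilon>_def)
  have exponent: "\<theta> + p * (1 - \<theta>) = 2 * p"
    using \<open>0 \<le> \<theta>\<close> by (simp add: p field_simps)
  \<comment> \<open>The maximum provides the constant of at least 1 that
    \<open>powr_interpolation_bound\<close> asks for.\<close>
  have "A powr \<theta> * E powr (1 - \<theta>) \<le> (1 + c) * max 1 \<epsilon> * \<eta> powr (2 * p)"
    using powr_interpolation_bound[of A c \<eta> E "max 1 \<epsilon>" p \<theta>] assms
    unfolding exponent by (simp add: E_eq mult_right_mono)
  then have "E\<^sup>2 \<le> G * \<eta> powr (2 * p) + 2 * M * ((1 + c) * max 1 \<epsilon> * \<eta> powr (2 * p))"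
    using E \<open>0 \<le> M\<close> by (smt (verit) mult_left_mono)
  moreover have "E\<^sup>2 = \<epsilon>\<^sup>2 * \<eta> powr (2 * p)"
    by (simp add: E_eq power2_eq_square flip: powr_add)
  ultimately have "\<epsilon>\<^sup>2 * \<eta> powr (2 * p) \<le> (G + 2 * M * (1 + c) * max 1 \<epsilon>) * \<eta> powr (2 * p)"
    by (simp add: algebra_simps)
  then have le: "\<epsilon>\<^sup>2 \<le> G + 2 * M * (1 + c) * max 1 \<epsilon>"
    using \<open>0 < \<eta>\<close> by simp
  have pos: "0 \<le> 2 * M * (1 + c)"
    using assms by simp
  have "\<epsilon> \<le> 1 + G + 2 * M * (1 + c)"
  proof (cases "\<epsilon> \<le> 1")
    case True
    then show ?thesis using pos \<open>0 \<le> G\<close> by linarith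
  next
    case False
    \<comment> \<open>Now \<open>max 1 \<epsilon> = \<epsilon>\<close>, so the right-hand side is at
      most linear in \<open>\<epsilon>\<close> and one factor cancels.\<close>
    then have "G \<le> G * \<epsilon>"
      using \<open>0 \<le> G\<close> by (simp add: mult_le_cancel_left1)
    then have "\<epsilon> * \<epsilon> \<le> (G + 2 * M * (1 + c)) * \<epsilon>"
      using le False by (simp add: power2_eq_square distrib_right)
    then show ?thesis
      using False by simp
  qed
  then show ?thesis
    unfolding E_eq by (rule mult_right_mono) simp
qed

text \<open>Dividing by \<open>D powr q\<close> leaves \<open>D powr (2 - q) \<le> B\<close>, whose
  left-hand side is monotone in \<open>D\<close>. An estimate at a discrepancy known only to be
  large thus passes down to the noise level.\<close>

lemma square_le_powr_antimono:
  fixes D D0 B q :: real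
  assumes "0 < D0" "D0 \<le> D" "q \<le> 2" "D\<^sup>2 \<le> B * D powr q"
  shows "D0\<^sup>2 \<le> B * D0 powr q"
proof -
  have sq: "x\<^sup>2 = x powr (2 - q) * x powr q" if "x > 0" for x :: real
    using that by (simp flip: powr_add)
  have "D > 0" using assms by simp
  then have "D powr (2 - q) \<le> B"
    using assms(4) sq[of D] by simp
  moreover have "D0 powr (2 - q) \<le> D powr (2 - q)"
    using assms by (intro powr_mono2) auto
  ultimately show ?thesis
    using sq[OF assms(1)] by (simp add: mult_right_mono)
qed

text \<open>This brings the exponent of the rate into the form
  \<open>\<theta> / (1 + \<theta>)\<close> that \<open>quadratic_interpolation_bound\<close>
  expects.\<close>

lemma interpolation_exponent:
  fixes a s u :: real
  assumes "- a < s" "s \<le> u"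
  shows "(u - s) / (u + a) = (u - s) / (s + a) / (1 + (u - s) / (s + a))"
proof -
  have "1 + (u - s) / (s + a) = (u + a) / (s + a)"
    using assms by (simp add: field_simps)
  then show ?thesis
    using assms by simp
qed

section \<open>Error estimates for approximate minimizers at a single parameter\<close>

context hilbert_scale
begin

text \<open>The radius \<open>\<rho>\<close> stays free, subject only to containing
  \<open>xdag\<close>, because noisy and exact data call for different radii.\<close>

context
  fixes R :: "real \<Rightarrow> real" and a s \<gamma> u \<delta> \<rho> c :: real and DF :: "'a set"
    and F :: "'a \<Rightarrow> 'b::{real_inner,complete_space}" and xdag :: 'a and yd :: 'b
  assumes stability: "conditional_stability DL L a s \<gamma> R DF F"
    and R_nonneg: "\<forall>\<rho>\<ge>0. 0 \<le> R \<rho>"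
    and a_s: "- a \<le> s" and s_u: "s \<le> u" and u_le: "u \<le> 2 * s + a"
    and gamma: "0 < \<gamma>" "\<gamma> \<le> 1"
    and xdag: "xdag \<in> DF" "xdag \<in> scale_space DL L u"
    and noise: "norm (yd - F xdag) \<le> \<delta>"
    and xdag_le: "scale_norm DL L s xdag \<le> \<rho>"
    and c: "c = R \<rho>"
begin

lemma c_nonneg: "0 \<le> c"
  using R_nonneg c order_trans[OF scale_norm_nonneg xdag_le] by simp

lemma xdag_in_scale: "xdag \<in> scale_space DL L s"
  using scale_space_mono xdag(2) s_u by blast

context
  fixes \<alpha> :: real and x :: 'a
  assumes x: "x \<in> approx_minimizers DL L s DF F \<delta> \<alpha> yd" and alpha: "0 < \<alpha>"
begin

text \<open>The comparison element is \<open>xdag\<close>: its finite functional value forces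
  \<open>x\<close> into the space of order \<open>s\<close>, and \<open>2 * \<delta>\<^sup>2\<close>
  collects the noise at \<open>xdag\<close> and the tolerance of the approximate
  minimization.\<close>

lemma
  shows minimizer_in_scale: "x \<in> scale_space DL L s"
    and minimizer_bound:
      "(norm (F x - yd))\<^sup>2 + \<alpha> * (scale_norm DL L s x)\<^sup>2 \<le> 2 * \<delta>\<^sup>2 + \<alpha> * (scale_norm DL L s xdag)\<^sup>2"
proof -
  let ?T = "(norm (F xdag - yd))\<^sup>2 + \<alpha> * (scale_norm DL L s xdag)\<^sup>2"
  have "tikhonov DL L s F \<alpha> yd x \<le> (INF z\<in>DF. tikhonov DL L s F \<alpha> yd z) + ennreal (\<delta>\<^sup>2)"
    using x by (simp add: approx_minimizers_def)
  also have "\<dots> \<le> tikhonov DL L s F \<alpha> yd xdag + ennreal (\<delta>\<^sup>2)"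
    by (intro add_right_mono INF_lower xdag)
  also have "\<dots> = ennreal (?T + \<delta>\<^sup>2)"
    using alpha xdag_in_scale by (simp add: tikhonov_def)
  finally have le: "tikhonov DL L s F \<alpha> yd x \<le> ennreal (?T + \<delta>\<^sup>2)" .
  then show scale: "x \<in> scale_space DL L s"
    by (auto simp: tikhonov_def top_unique split: if_splits)
  have "(norm (F xdag - yd))\<^sup>2 \<le> \<delta>\<^sup>2"
    using noise by (simp add: norm_minus_commute power_mono)
  moreover have "(norm (F x - yd))\<^sup>2 + \<alpha> * (scale_norm DL L s x)\<^sup>2 \<le> ?T + \<delta>\<^sup>2"
    using le alpha scale by (simp add: tikhonov_def ennreal_le_iff del: ennreal_plus)
  ultimately show "(norm (F x - yd))\<^sup>2 + \<alpha> * (scale_norm DL L s x)\<^sup>2 \<le>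
      2 * \<delta>\<^sup>2 + \<alpha> * (scale_norm DL L s xdag)\<^sup>2"
    by simp
qed

lemma error_in_scale: "r \<le> s \<Longrightarrow> x - xdag \<in> scale_space DL L r"
  using scale_space_mono scale_space_diff minimizer_in_scale xdag_in_scale by blast

lemma weak_error_bound:
  assumes "scale_norm DL L s x \<le> \<rho>" "norm (F x - F xdag) \<le> D"
  shows "scale_norm DL L (- a) (x - xdag) \<le> c * D powr \<gamma>"
proof -
  have "0 \<le> \<rho>"
    using order_trans[OF scale_norm_nonneg xdag_le] .
  then have "scale_norm DL L (- a) (x - xdag) \<le> R \<rho> * norm (F x - F xdag) powr \<gamma>"
    using stability minimizer_in_scale xdag_in_scale assms(1) xdag(1) xdag_le x
    by (simp add: conditional_stability_def stability_set_def approx_minimizers_def)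
  also have "\<dots> \<le> c * D powr \<gamma>"
    unfolding c using assms(2) gamma \<open>0 \<le> \<rho>\<close> R_nonneg by (intro mult_left_mono powr_mono2) auto
  finally show ?thesis .
qed

text \<open>The exponent \<open>\<theta>\<close> places order \<open>2 * s - u\<close> between
  \<open>- a\<close> and \<open>s\<close>; the condition \<open>u \<le> 2 * s + a\<close> is exactly
  \<open>\<theta> \<le> 1\<close>.\<close>

lemma strong_error_bound:
  assumes "- a < s"
  defines "\<theta> \<equiv> (u - s) / (s + a)"
  shows "(norm (F x - yd))\<^sup>2 + \<alpha> * (scale_norm DL L s (x - xdag))\<^sup>2 \<le> 2 * \<delta>\<^sup>2 +
    2 * \<alpha> * scale_norm DL L u xdag *
      (scale_norm DL L (- a) (x - xdag) powr \<theta> * scale_norm DL L s (x - xdag) powr (1 - \<theta>))"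
proof -
  have "scale_norm DL L (2 * s - u) (x - xdag) \<le>
      scale_norm DL L (- a) (x - xdag) powr \<theta> * scale_norm DL L s (x - xdag) powr (1 - \<theta>)"
  proof (rule scale_norm_interpolation)
    show "0 \<le> \<theta>" "\<theta> \<le> 1"
      using assms(1) s_u u_le by (auto simp: \<theta>_def)
    have "\<theta> * (s + a) = u - s"
      using assms(1) by (simp add: \<theta>_def)
    then show "2 * s - u = \<theta> * (- a) + (1 - \<theta>) * s"
      by (simp add: algebra_simps)
  qed (use error_in_scale a_s s_u in auto)
  then have cross: "scale_norm DL L (2 * s - u) (x - xdag) * scale_norm DL L u xdag \<le>
      scale_norm DL L u xdag *
      (scale_norm DL L (- a) (x - xdag) powr \<theta> * scale_norm DL L s (x - xdag) powr (1 - \<theta>))"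
    by (metis mult.commute mult_left_mono scale_norm_nonneg)
  have "(scale_norm DL L s (x - xdag))\<^sup>2 \<le> (scale_norm DL L s x)\<^sup>2 - (scale_norm DL L s xdag)\<^sup>2 + 2 *
      (scale_norm DL L u xdag *
      (scale_norm DL L (- a) (x - xdag) powr \<theta> * scale_norm DL L s (x - xdag) powr (1 - \<theta>)))"
    using scale_norm_diff_le[OF minimizer_in_scale xdag(2) s_u] cross by linarith
  then have "\<alpha> * (scale_norm DL L s (x - xdag))\<^sup>2 \<le> \<alpha> * ((scale_norm DL L s x)\<^sup>2 - (scale_norm DL L s xdag)\<^sup>2 + 2 *
      (scale_norm DL L u xdag *
      (scale_norm DL L (- a) (x - xdag) powr \<theta> * scale_norm DL L s (x - xdag) powr (1 - \<theta>))))"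
    using alpha by (intro mult_left_mono) auto
  then show ?thesis
    using minimizer_bound by (simp add: algebra_simps)
qed

text \<open>Applied to the last rejected parameter, which is twice the accepted one, this bounds the accepted one from below.\<close>

lemma large_discrepancy:
  assumes large: "4 * \<delta> < norm (F x - yd)" and "0 < \<delta>"
  shows "14 * \<delta>\<^sup>2 \<le> \<alpha> * (scale_norm DL L s xdag)\<^sup>2"
    and "- a < s \<Longrightarrow> M = scale_norm DL L u xdag \<Longrightarrow>
      (5 * \<delta>)\<^sup>2 \<le> 4 * \<alpha> * (M * (1 + c) * (1 + 2 * M * (1 + c))) *
        (5 * \<delta>) powr (2 * \<gamma> * ((u - s) / (u + a)))"
proof -
  define d where "d = norm (F x - yd)"
  \<comment> \<open>The residual contributes at least \<open>16 * \<delta>\<^sup>2\<close>, against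
    \<open>2 * \<delta>\<^sup>2\<close> on the right; this leaves the factor 14.\<close>
  have "(4 * \<delta>)\<^sup>2 \<le> d\<^sup>2"
    using large \<open>0 < \<delta>\<close> unfolding d_def by (intro power_mono) auto
  then have d2: "16 * \<delta>\<^sup>2 \<le> d\<^sup>2"
    by (simp add: power_mult_distrib)
  have bound: "d\<^sup>2 + \<alpha> * (scale_norm DL L s x)\<^sup>2 \<le> 2 * \<delta>\<^sup>2 + \<alpha> * (scale_norm DL L s xdag)\<^sup>2"
    using minimizer_bound by (simp add: d_def)
  moreover have "0 \<le> \<alpha> * (scale_norm DL L s x)\<^sup>2"
    using alpha by simp
  ultimately show "14 * \<delta>\<^sup>2 \<le> \<alpha> * (scale_norm DL L s xdag)\<^sup>2"
    using d2 by linarith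
  assume a_lt: "- a < s" and M: "M = scale_norm DL L u xdag"
  define \<theta> where "\<theta> = (u - s) / (s + a)"
  define p where "p = (u - s) / (u + a)"
  \<comment> \<open>Since \<open>\<delta> < d / 4\<close>, this bounds
    \<open>norm (F x - F xdag)\<close>, and it exceeds \<open>5 * \<delta>\<close>.\<close>
  define D where "D = 5 / 4 * d"
  define A where "A = scale_norm DL L (- a) (x - xdag)"
  define E where "E = scale_norm DL L s (x - xdag)"
  have nonneg: "0 \<le> A" "0 \<le> E" "0 \<le> M"
    by (auto simp: A_def E_def M)
  have \<theta>: "0 \<le> \<theta>" "\<theta> \<le> 1" and p: "0 \<le> p" "p \<le> 1"
    using a_lt s_u u_le by (auto simp: \<theta>_def p_def)
  have p_eq: "p = \<theta> / (1 + \<theta>)"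
    unfolding \<theta>_def p_def by (rule interpolation_exponent[OF a_lt s_u])
  have D: "0 < D" "5 * \<delta> \<le> D"
    using large \<open>0 < \<delta>\<close> by (auto simp: D_def d_def)
  \<comment> \<open>A large discrepancy leaves no room for a larger penalty, so \<open>x\<close>
    lies in the same ball as \<open>xdag\<close>.\<close>
  have "\<alpha> * (scale_norm DL L s x)\<^sup>2 \<le> \<alpha> * (scale_norm DL L s xdag)\<^sup>2"
    using bound d2 zero_le_power2[of \<delta>] by linarith
  then have "(scale_norm DL L s x)\<^sup>2 \<le> (scale_norm DL L s xdag)\<^sup>2"
    using mult_le_cancel_left_pos[OF alpha] by blast
  then have "scale_norm DL L s x \<le> scale_norm DL L s xdag"
    by (rule power2_le_imp_le) simp
  moreover have "norm (F x - F xdag) \<le> norm (F x - yd) + norm (yd - F xdag)"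
    using norm_triangle_ineq[of "F x - yd" "yd - F xdag"] by simp
  ultimately have A: "A \<le> c * D powr \<gamma>"
    unfolding A_def using xdag_le noise large by (intro weak_error_bound) (auto simp: D_def d_def)
  have main: "d\<^sup>2 + \<alpha> * E\<^sup>2 \<le> 2 * \<delta>\<^sup>2 + 2 * \<alpha> * M * (A powr \<theta> * E powr (1 - \<theta>))"
    unfolding d_def A_def E_def M \<theta>_def by (rule strong_error_bound[OF a_lt])
  then have "\<alpha> * E\<^sup>2 \<le> 2 * \<alpha> * M * (A powr \<theta> * E powr (1 - \<theta>))"
    using d2 zero_le_power2[of \<delta>] by linarith
  then have "\<alpha> * E\<^sup>2 \<le> \<alpha> * (2 * M * (A powr \<theta> * E powr (1 - \<theta>)))"
    by (simp add: mult_ac)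
  \<comment> \<open>The residual has absorbed the noise term, so the quadratic bound applies with
    \<open>G = 0\<close>.\<close>
  then have "E\<^sup>2 \<le> 0 * (D powr \<gamma>) powr (2 * p) + 2 * M * (A powr \<theta> * E powr (1 - \<theta>))"
    using alpha by simp
  then have E: "E \<le> (1 + 0 + 2 * M * (1 + c)) * (D powr \<gamma>) powr p"
    using A D \<theta> p_eq nonneg c_nonneg by (intro quadratic_interpolation_bound) auto
  have "\<theta> + p * (1 - \<theta>) = 2 * p"
    using \<theta> by (simp add: p_eq field_simps)
  then have cross: "A powr \<theta> * E powr (1 - \<theta>) \<le>
      (1 + c) * (1 + 2 * M * (1 + c)) * D powr (2 * \<gamma> * p)"
    using powr_interpolation_bound[OF nonneg(1) A nonneg(2) E c_nonneg _ _ \<theta>] D nonneg c_nonneg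
    by (simp add: powr_powr mult_ac)
  \<comment> \<open>Here \<open>2 * \<delta>\<^sup>2 \<le> d\<^sup>2 / 8\<close>. Passing from
    \<open>d\<close> to \<open>D\<close> gives the factor
    \<open>16 / 7 * (25 / 16) = 25 / 7\<close>, rounded up to 4.\<close>
  have "7 / 8 * d\<^sup>2 \<le> 2 * \<alpha> * M * (A powr \<theta> * E powr (1 - \<theta>))"
    using main d2 alpha zero_le_power2[of E] mult_nonneg_nonneg[of \<alpha> "E\<^sup>2"] by linarith
  also have "\<dots> \<le> 2 * \<alpha> * M * ((1 + c) * (1 + 2 * M * (1 + c)) * D powr (2 * \<gamma> * p))"
    using alpha nonneg by (intro mult_left_mono cross) auto
  also have "\<dots> = 2 * (\<alpha> * (M * (1 + c) * (1 + 2 * M * (1 + c))) * D powr (2 * \<gamma> * p))"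
    by (simp only: mult_ac)
  finally have "d\<^sup>2 \<le> 16 / 7 * (\<alpha> * (M * (1 + c) * (1 + 2 * M * (1 + c))) * D powr (2 * \<gamma> * p))"
    by linarith
  moreover have "D\<^sup>2 = 25 / 16 * d\<^sup>2"
    by (simp add: D_def power2_eq_square)
  moreover have "0 \<le> \<alpha> * (M * (1 + c) * (1 + 2 * M * (1 + c))) * D powr (2 * \<gamma> * p)"
    using alpha nonneg c_nonneg by simp
  ultimately have "D\<^sup>2 \<le> 4 * \<alpha> * (M * (1 + c) * (1 + 2 * M * (1 + c))) * D powr (2 * \<gamma> * p)"
    by linarith
  moreover have "2 * \<gamma> * p \<le> 2"
    using mult_le_one[OF gamma(2) p] by simp
  ultimately show "(5 * \<delta>)\<^sup>2 \<le> 4 * \<alpha> * (M * (1 + c) * (1 + 2 * M * (1 + c))) *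
        (5 * \<delta>) powr (2 * \<gamma> * ((u - s) / (u + a)))"
    unfolding p_def[symmetric] using \<open>0 < \<delta>\<close> D(2) by (intro square_le_powr_antimono[of "5 * \<delta>" D]) simp_all
qed

text \<open>The premise \<open>parameter\<close> keeps \<open>\<delta>\<^sup>2 / \<alpha>\<close> at
  the size of the squared rate of order \<open>s\<close>, so the noise term fits into the quadratic
  inequality for \<open>E\<close>; orders below \<open>s\<close> follow by interpolation.\<close>

lemma convergence_rate:
  assumes "- a < s" "0 < \<delta>" "0 \<le> G"
    and small: "norm (F x - yd) \<le> 4 * \<delta>" and x_le: "scale_norm DL L s x \<le> \<rho>"
    and parameter: "(5 * \<delta>)\<^sup>2 \<le> \<alpha> * G * (5 * \<delta>) powr (2 * \<gamma> * ((u - s) / (u + a)))"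
    and r: "- a \<le> r" "r \<le> s" and M: "M = scale_norm DL L u xdag"
  shows "scale_norm DL L r (x - xdag) \<le>
    5 * (1 + c) * (1 + G + 2 * M * (1 + c)) * \<delta> powr (\<gamma> * ((u - r) / (u + a)))"
proof -
  define \<theta> where "\<theta> = (u - s) / (s + a)"
  define p where "p = (u - s) / (u + a)"
  define q where "q = (u - r) / (u + a)"
  define t where "t = (s - r) / (s + a)"
  define A where "A = scale_norm DL L (- a) (x - xdag)"
  define E where "E = scale_norm DL L s (x - xdag)"
  define B where "B = 1 + G + 2 * M * (1 + c)"
  have nonneg: "0 \<le> A" "0 \<le> E" "0 \<le> M"
    by (auto simp: A_def E_def M)
  then have B: "1 \<le> B"
    using c_nonneg \<open>0 \<le> G\<close> by (simp add: B_def)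
  have \<theta>: "0 \<le> \<theta>" "\<theta> \<le> 1" and q: "0 \<le> q" "q \<le> 1" and t: "0 \<le> t" "t \<le> 1"
    using assms(1) s_u u_le r by (auto simp: \<theta>_def q_def t_def)
  have p: "p = \<theta> / (1 + \<theta>)"
    unfolding \<theta>_def p_def by (rule interpolation_exponent[OF assms(1) s_u])
  have "norm (F x - F xdag) \<le> norm (F x - yd) + norm (yd - F xdag)"
    using norm_triangle_ineq[of "F x - yd" "yd - F xdag"] by simp
  then have A: "A \<le> c * (5 * \<delta>) powr \<gamma>"
    unfolding A_def using small noise by (intro weak_error_bound[OF x_le]) simp
  have "(norm (F x - yd))\<^sup>2 + \<alpha> * E\<^sup>2 \<le> 2 * \<delta>\<^sup>2 + 2 * \<alpha> * M * (A powr \<theta> * E powr (1 - \<theta>))"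
    unfolding A_def E_def M \<theta>_def by (rule strong_error_bound[OF assms(1)])
  moreover have "2 * \<delta>\<^sup>2 \<le> (5 * \<delta>)\<^sup>2"
    by (simp add: power2_eq_square)
  ultimately have "\<alpha> * E\<^sup>2 \<le> \<alpha> * G * (5 * \<delta>) powr (2 * \<gamma> * p) + 2 * \<alpha> * M * (A powr \<theta> * E powr (1 - \<theta>))"
    using parameter zero_le_power2[of "norm (F x - yd)"] unfolding p_def[symmetric] by linarith
  then have "\<alpha> * E\<^sup>2 \<le> \<alpha> * (G * ((5 * \<delta>) powr \<gamma>) powr (2 * p) + 2 * M * (A powr \<theta> * E powr (1 - \<theta>)))"
    by (simp add: powr_powr distrib_left mult_ac)
  then have "E\<^sup>2 \<le> G * ((5 * \<delta>) powr \<gamma>) powr (2 * p) + 2 * M * (A powr \<theta> * E powr (1 - \<theta>))"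
    using alpha by simp
  then have E: "E \<le> B * ((5 * \<delta>) powr \<gamma>) powr p"
    unfolding B_def using A \<theta> p nonneg c_nonneg assms(2,3)
    by (intro quadratic_interpolation_bound) auto
  have "t * (s + a) = s - r"
    using assms(1) by (simp add: t_def)
  then have "r = t * (- a) + (1 - t) * s"
    by (simp add: algebra_simps)
  then have "scale_norm DL L r (x - xdag) \<le> A powr t * E powr (1 - t)"
    unfolding A_def E_def using error_in_scale a_s r t by (intro scale_norm_interpolation) auto
  also have "\<dots> \<le> (1 + c) * B * ((5 * \<delta>) powr \<gamma>) powr (t + p * (1 - t))"
    using assms(2) by (intro powr_interpolation_bound nonneg A E c_nonneg B t) simp
  \<comment> \<open>The exponent is affine in \<open>r\<close>, with value 1 at \<open>- a\<close>
    and \<open>p\<close> at \<open>s\<close>.\<close>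
  also have "t + p * (1 - t) = q"
    using assms(1) s_u by (simp add: t_def p_def q_def divide_simps) (simp add: algebra_simps)
  also have "((5 * \<delta>) powr \<gamma>) powr q = 5 powr (\<gamma> * q) * \<delta> powr (\<gamma> * q)"
    using assms(2) by (simp add: powr_powr powr_mult)
  also have "(1 + c) * B * (5 powr (\<gamma> * q) * \<delta> powr (\<gamma> * q)) \<le> (1 + c) * B * (5 powr 1 * \<delta> powr (\<gamma> * q))"
    using c_nonneg B gamma q by (intro mult_left_mono mult_right_mono powr_mono) (auto simp: mult_le_one)
  also have "\<dots> = 5 * (1 + c) * B * \<delta> powr (\<gamma> * q)"
    by simp
  finally show ?thesis
    by (simp only: B_def q_def)
qed

end

text \<open>If every index were rejected, \<open>14 * \<delta>\<^sup>2\<close> would stay below a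
  multiple of every parameter, and the parameters tend to zero.\<close>

lemma discrepancy_attained:
  assumes "0 < \<delta>" and xs: "\<forall>n. xs n \<in> approx_minimizers DL L s DF F \<delta> (reg_param n) yd"
  shows "\<exists>n. norm (F (xs n) - yd) \<le> 4 * \<delta>"
proof (rule ccontr)
  assume contra: "\<not> ?thesis"
  have "14 * \<delta>\<^sup>2 \<le> (1/2) ^ n * (scale_norm DL L s xdag)\<^sup>2" for n
  proof -
    have "reg_param n = (1/2) ^ n"
      by (simp add: reg_param_def powr_minus powr_realpow power_one_over inverse_eq_divide)
    moreover have "xs n \<in> approx_minimizers DL L s DF F \<delta> (reg_param n) yd" "4 * \<delta> < norm (F (xs n) - yd)"
      using xs contra by (auto simp: not_le)
    ultimately show ?thesis
      using large_discrepancy(1)[of "xs n" "reg_param n"] assms(1) by simp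
  qed
  moreover have "(\<lambda>n. (1/2) ^ n * (scale_norm DL L s xdag)\<^sup>2) \<longlonglongrightarrow> 0 * (scale_norm DL L s xdag)\<^sup>2"
    by (intro tendsto_mult LIMSEQ_power_zero tendsto_const) simp
  ultimately have "14 * \<delta>\<^sup>2 \<le> 0 * (scale_norm DL L s xdag)\<^sup>2"
    by (intro LIMSEQ_le_const) auto
  then show False using assms(1) by simp
qed

end

end

text \<open>\<open>C5\<close> is chosen before the operator, its domain, the data and the
  minimizers, so these enter only through the norm of \<open>xdag\<close> of order \<open>u\<close>.
  The stopping rule tests the chosen sequence only; another minimizer for the same parameter brings
  its own discrepancy bound as a premise. With exact data no index need pass the test, hence the
  disjunction.\<close>

theorem theorem2p2:
  fixes DL :: "'a::{real_inner,complete_space} set" and L :: "'a \<Rightarrow> 'a"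
    and R :: "real \<Rightarrow> real" and a s \<gamma> u \<delta>max :: real
  assumes "scale_generator DL L"
    and "\<forall>\<rho>\<ge>0. 0 \<le> R \<rho>"
    and "0 \<le> a" and "0 < \<gamma>" and "\<gamma> \<le> 1"
    and "- a \<le> s" and "s \<le> u" and "u \<le> 2 * s + a"
  shows "\<exists>C5 :: real \<Rightarrow> real.
    \<forall>(DF :: 'a set) (F :: 'a \<Rightarrow> 'b::{real_inner,complete_space})
      (xdag :: 'a) (y :: 'b) (yd :: 'b) (\<delta> :: real) (xs :: nat \<Rightarrow> 'a).
      conditional_stability DL L a s \<gamma> R DF F \<longrightarrow>
      xdag \<in> DF \<inter> scale_space DL L u \<longrightarrow> y = F xdag \<longrightarrow>
      norm (yd - y) \<le> \<delta> \<longrightarrow> \<delta> \<le> \<delta>max \<longrightarrow>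
      (\<forall>n. xs n \<in> approx_minimizers DL L s DF F \<delta> (reg_param n) yd) \<longrightarrow>
      (0 < \<delta> \<or> (\<exists>n. norm (F (xs n) - yd) \<le> 4 * \<delta>)) \<longrightarrow>
      norm (F (xs (stopping_index F \<delta> yd xs)) - yd) \<le> 4 * \<delta> \<and>
      (\<forall>x \<in> approx_minimizers DL L s DF F \<delta> (reg_param (stopping_index F \<delta> yd xs)) yd.
         norm (F x - yd) \<le> 4 * \<delta> \<longrightarrow>
         (\<forall>r. - a \<le> r \<longrightarrow> r \<le> s \<longrightarrow>
            x - xdag \<in> scale_space DL L r \<and>
            scale_norm DL L r (x - xdag)
              \<le> C5 (scale_norm DL L u xdag) * \<delta> powr (\<gamma> * ((u - r) / (u + a)))))"
proof -
  interpret hilbert_scale DL L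
    by unfold_locales (rule assms(1))
  obtain \<kappa> where \<kappa>: "0 \<le> \<kappa>" "\<And>x. x \<in> scale_space DL L u \<Longrightarrow> scale_norm DL L s x \<le> \<kappa> * scale_norm DL L u x"
    using scale_norm_embedding[OF assms(7)] by blast
  \<comment> \<open>The radius must hold both \<open>xdag\<close> and the accepted minimizer, whose
    squared norm is shown below to be at most \<open>(2 * \<bar>\<delta>max\<bar>)\<^sup>2 + 2 *
    (\<kappa> * M)\<^sup>2\<close>.\<close>
  define \<rho> where "\<rho> = (\<lambda>M. 2 * \<kappa> * M + 2 * \<bar>\<delta>max\<bar>)"
  define c where "c = (\<lambda>M. R (\<rho> M))"
  \<comment> \<open>The first summand serves acceptance at index 0, the second the case of a
    rejected predecessor. The last factor of \<open>C5\<close> serves the degenerate case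
    \<open>s = - a\<close>.\<close>
  define G where "G = (\<lambda>M. (1 + 5 * \<bar>\<delta>max\<bar>)\<^sup>2 + 8 * (M * (1 + c M) * (1 + 2 * M * (1 + c M))))"
  define C5 where "C5 = (\<lambda>M. 5 * (1 + c M) * (1 + G M + 2 * M * (1 + c M)) * (1 + 5 * \<bar>\<delta>max\<bar>))"
  show ?thesis
  proof (rule exI[of _ C5], intro allI impI)
    fix DF and F :: "'a \<Rightarrow> 'b" and xdag y yd \<delta> xs
    assume stability: "conditional_stability DL L a s \<gamma> R DF F"
      and xdag: "xdag \<in> DF \<inter> scale_space DL L u" and y: "y = F xdag"
      and noise: "norm (yd - y) \<le> \<delta>" and \<delta>max: "\<delta> \<le> \<delta>max"
      and xs: "\<forall>n. xs n \<in> approx_minimizers DL L s DF F \<delta> (reg_param n) yd"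
      and attained: "0 < \<delta> \<or> (\<exists>n. norm (F (xs n) - yd) \<le> 4 * \<delta>)"
    define M where "M = scale_norm DL L u xdag"
    have nonneg: "0 \<le> \<delta>" "0 \<le> M" "0 \<le> \<rho> M" "0 \<le> c M" "0 \<le> G M"
      and M_le: "scale_norm DL L s xdag \<le> \<kappa> * M" "\<kappa> * M \<le> \<rho> M"
    proof -
      show "0 \<le> \<delta>"
        using noise order_trans[OF norm_ge_zero] by blast
      show M: "0 \<le> M" and "scale_norm DL L s xdag \<le> \<kappa> * M"
        using xdag \<kappa>(2) by (auto simp: M_def)
      show "\<kappa> * M \<le> \<rho> M" "0 \<le> \<rho> M"
        using M \<kappa>(1) by (simp_all add: \<rho>_def)
      then show c: "0 \<le> c M"
        using assms(2) by (simp add: c_def)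
      show "0 \<le> G M"
        using M c by (simp add: G_def)
    qed
    have data: "- a \<le> s" "s \<le> u" "u \<le> 2 * s + a" "0 < \<gamma>" "\<gamma> \<le> 1" "xdag \<in> DF" "xdag \<in> scale_space DL L u"
      "norm (yd - F xdag) \<le> \<delta>"
      using assms xdag noise y by auto
    note ctx = stability assms(2) data
    define N where "N = stopping_index F \<delta> yd xs"
    have "\<exists>n. norm (F (xs n) - yd) \<le> 4 * \<delta>"
      using attained discrepancy_attained[OF ctx order_trans[OF M_le] refl _ xs] by blast
    then have stop: "norm (F (xs N) - yd) \<le> 4 * \<delta>"
      unfolding N_def stopping_index_def using Inf_nat_def1[of "{n. norm (F (xs n) - yd) \<le> 4 * \<delta>}"] by auto
    define \<alpha> where "\<alpha> = reg_param N"
    have \<alpha>: "0 < \<alpha>"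
      by (simp add: \<alpha>_def reg_param_def)
    have "x - xdag \<in> scale_space DL L r \<and>
        scale_norm DL L r (x - xdag) \<le> C5 M * \<delta> powr (\<gamma> * ((u - r) / (u + a)))"
      if x: "x \<in> approx_minimizers DL L s DF F \<delta> \<alpha> yd" and small: "norm (F x - yd) \<le> 4 * \<delta>"
        and r: "- a \<le> r" "r \<le> s" for x r
    proof -
      have err: "norm (F x - F xdag) \<le> 5 * \<delta>"
        using norm_triangle_ineq[of "F x - yd" "yd - F xdag"] small data(8) by simp
      note in_scale = error_in_scale[OF ctx _ refl x \<alpha>]
      have "scale_norm DL L r (x - xdag) \<le> C5 M * \<delta> powr (\<gamma> * ((u - r) / (u + a)))"
      proof (cases "\<delta> = 0")
        \<comment> \<open>Here the error must vanish in every norm, since \<open>0 powr 0 = 0\<close> for \<open>r = u\<close>.\<close>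
        case True
        \<comment> \<open>This radius may depend on \<open>x\<close>, since its stability constant
          is multiplied by \<open>0 powr \<gamma> = 0\<close>.\<close>
        define \<rho>' where "\<rho>' = max (scale_norm DL L s x) (scale_norm DL L s xdag)"
        have "scale_norm DL L (- a) (x - xdag) \<le> R \<rho>' * (5 * \<delta>) powr \<gamma>"
          by (rule weak_error_bound[OF ctx _ refl x \<alpha> _ err]) (simp_all add: \<rho>'_def)
        then have "scale_norm DL L (- a) (x - xdag) = 0"
          using True by (simp add: antisym)
        then have "scale_norm DL L r (x - xdag) = 0"
          using in_scale[OF order.refl assms(6)] scale_norm_eq_0_transfer by blast
        then show ?thesis using True by simp
      next
        case False
        then have \<delta>: "0 < \<delta>" using nonneg(1) by simp
        have previous: "14 * \<delta>\<^sup>2 \<le> 2 * \<alpha> * (scale_norm DL L s xdag)\<^sup>2"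
          "- a < s \<Longrightarrow> (5 * \<delta>)\<^sup>2 \<le> 4 * (2 * \<alpha>) * (M * (1 + c M) * (1 + 2 * M * (1 + c M))) *
            (5 * \<delta>) powr (2 * \<gamma> * ((u - s) / (u + a)))" if N: "N \<noteq> 0"
        proof -
          have "reg_param (N - 1) = 2 * \<alpha>"
            using N powr_add[of 2 1 "- real N"] by (simp add: \<alpha>_def reg_param_def of_nat_diff)
          then have prev: "xs (N - 1) \<in> approx_minimizers DL L s DF F \<delta> (2 * \<alpha>) yd"
            using xs by metis
          \<comment> \<open>Because \<open>N\<close> is nonzero, \<open>N - 1\<close> lies strictly
            below the infimum and was rejected.\<close>
          have "N - 1 \<notin> {n. norm (F (xs n) - yd) \<le> 4 * \<delta>}"
            using N cInf_lower[of "N - 1" "{n. norm (F (xs n) - yd) \<le> 4 * \<delta>}"]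
            unfolding N_def stopping_index_def by fastforce
          then have large: "4 * \<delta> < norm (F (xs (N - 1)) - yd)"
            by simp
          note * = large_discrepancy[OF ctx order_trans[OF M_le] c_def[THEN fun_cong] prev _ large \<delta>]
          show "14 * \<delta>\<^sup>2 \<le> 2 * \<alpha> * (scale_norm DL L s xdag)\<^sup>2"
            using *(1) \<alpha> by simp
          show "(5 * \<delta>)\<^sup>2 \<le> 4 * (2 * \<alpha>) * (M * (1 + c M) * (1 + 2 * M * (1 + c M))) *
            (5 * \<delta>) powr (2 * \<gamma> * ((u - s) / (u + a)))" if "- a < s"
            using *(2)[OF _ that M_def] \<alpha> by simp
        qed
        \<comment> \<open>This is the uniform bound on \<open>\<delta>\<^sup>2 / \<alpha>\<close>:
          at index 0 the parameter is 1 and \<open>\<delta>max\<close> bounds the noise; otherwise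
          the rejected predecessor supplies it.\<close>
        have "2 * \<delta>\<^sup>2 \<le> \<alpha> * ((2 * \<bar>\<delta>max\<bar>)\<^sup>2 + (\<kappa> * M)\<^sup>2)"
        proof (cases "N = 0")
          case True
          have "2 * \<delta>\<^sup>2 \<le> 4 * \<bar>\<delta>max\<bar>\<^sup>2"
            using \<delta> \<delta>max power_mono[of \<delta> "\<bar>\<delta>max\<bar>" 2] zero_le_power2[of \<delta>] by linarith
          moreover have "\<alpha> * ((2 * \<bar>\<delta>max\<bar>)\<^sup>2 + (\<kappa> * M)\<^sup>2) = (2 * \<bar>\<delta>max\<bar>)\<^sup>2 + (\<kappa> * M)\<^sup>2"
            "0 \<le> (\<kappa> * M)\<^sup>2"
            using True by (simp_all add: \<alpha>_def reg_param_def)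
          moreover have "(2 * \<bar>\<delta>max\<bar>)\<^sup>2 = 4 * \<bar>\<delta>max\<bar>\<^sup>2"
            by simp
          ultimately show ?thesis
            by linarith
        next
          case False
          have "(scale_norm DL L s xdag)\<^sup>2 \<le> (\<kappa> * M)\<^sup>2"
            using M_le by (intro power_mono) auto
          then have "\<alpha> * (scale_norm DL L s xdag)\<^sup>2 \<le> \<alpha> * (\<kappa> * M)\<^sup>2"
            using \<alpha> by simp
          moreover have "0 \<le> \<alpha> * (2 * \<bar>\<delta>max\<bar>)\<^sup>2" "0 \<le> \<alpha> * (\<kappa> * M)\<^sup>2"
            using \<alpha> by simp_all
          ultimately show ?thesis
            using previous(1)[OF False] unfolding distrib_left by linarith
        qed
        moreover have "\<alpha> * (scale_norm DL L s x)\<^sup>2 \<le> 2 * \<delta>\<^sup>2 + \<alpha> * (scale_norm DL L s xdag)\<^sup>2"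
          using minimizer_bound[OF ctx order_trans[OF M_le] refl x \<alpha>] zero_le_power2[of "norm (F x - yd)"]
          by linarith
        moreover have "\<alpha> * (scale_norm DL L s xdag)\<^sup>2 \<le> \<alpha> * (\<kappa> * M)\<^sup>2"
          using \<alpha> M_le by (intro mult_left_mono power_mono) auto
        ultimately have "\<alpha> * (scale_norm DL L s x)\<^sup>2 \<le> \<alpha> * ((2 * \<bar>\<delta>max\<bar>)\<^sup>2 + 2 * (\<kappa> * M)\<^sup>2)"
          by (simp add: distrib_left)
        then have "(scale_norm DL L s x)\<^sup>2 \<le> (2 * \<bar>\<delta>max\<bar>)\<^sup>2 + 2 * (\<kappa> * M)\<^sup>2"
          using \<alpha> by simp
        also have "\<dots> \<le> (\<rho> M)\<^sup>2"
          using nonneg(2) \<kappa>(1) by (simp add: \<rho>_def power2_eq_square algebra_simps)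
        finally have x_le: "scale_norm DL L s x \<le> \<rho> M"
          using nonneg(3) by (rule power2_le_imp_le)
        show ?thesis
        proof (cases "- a < s")
          case a_s: True
          define q where "q = 2 * \<gamma> * ((u - s) / (u + a))"
          have parameter: "(5 * \<delta>)\<^sup>2 \<le> \<alpha> * G M * (5 * \<delta>) powr q"
          proof (cases "N = 0")
            case True
            have p: "0 \<le> (u - s) / (u + a)" "(u - s) / (u + a) \<le> 1"
              using assms(6-8) a_s by simp_all
            have "\<gamma> * ((u - s) / (u + a)) \<le> 1" "0 \<le> \<gamma> * ((u - s) / (u + a))"
              using p assms(4,5) by (simp_all only: mult_le_one mult_nonneg_nonneg less_imp_le)
            then have q: "0 \<le> q" "q \<le> 2"
              unfolding q_def by linarith+
            \<comment> \<open>Without a rejected predecessor, the estimate is checked at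
              \<open>1 + 5 * \<bar>\<delta>max\<bar>\<close>, where it holds because the base is at
              least 1, and then passed down to \<open>5 * \<delta>\<close>.\<close>
            have "1 \<le> (1 + 5 * \<bar>\<delta>max\<bar>) powr q"
              using q(1) by (intro ge_one_powr_ge_zero) simp_all
            then have *: "(1 + 5 * \<bar>\<delta>max\<bar>)\<^sup>2 \<le> (1 + 5 * \<bar>\<delta>max\<bar>)\<^sup>2 * (1 + 5 * \<bar>\<delta>max\<bar>) powr q"
              using mult_left_mono[of 1 "(1 + 5 * \<bar>\<delta>max\<bar>) powr q" "(1 + 5 * \<bar>\<delta>max\<bar>)\<^sup>2"] by simp
            have "0 < 5 * \<delta>" "5 * \<delta> \<le> 1 + 5 * \<bar>\<delta>max\<bar>"
              using \<delta> \<delta>max by linarith+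
            then have "(5 * \<delta>)\<^sup>2 \<le> (1 + 5 * \<bar>\<delta>max\<bar>)\<^sup>2 * (5 * \<delta>) powr q"
              using q(2) * by (rule square_le_powr_antimono)
            also have "\<dots> \<le> G M * (5 * \<delta>) powr q"
              using nonneg by (intro mult_right_mono) (simp_all add: G_def)
            finally show ?thesis
              using True by (simp add: \<alpha>_def reg_param_def)
          next
            case False
            \<comment> \<open>The 8 is the factor 4 of \<open>large_discrepancy\<close> doubled, as
              the rejected parameter is \<open>2 * \<alpha>\<close>.\<close>
            have "(5 * \<delta>)\<^sup>2 \<le> \<alpha> * (8 * (M * (1 + c M) * (1 + 2 * M * (1 + c M)))) * (5 * \<delta>) powr q"
            proof -
              have "4 * (2 * \<alpha>) * (M * (1 + c M) * (1 + 2 * M * (1 + c M))) =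
                  \<alpha> * (8 * (M * (1 + c M) * (1 + 2 * M * (1 + c M))))"
                by simp
              then show ?thesis
                using previous(2)[OF False a_s] by (simp only: q_def)
            qed
            also have "\<dots> \<le> \<alpha> * G M * (5 * \<delta>) powr q"
              using \<alpha> by (intro mult_right_mono mult_left_mono) (simp_all add: G_def)
            finally show ?thesis .
          qed
          have "scale_norm DL L r (x - xdag) \<le>
              5 * (1 + c M) * (1 + G M + 2 * M * (1 + c M)) * \<delta> powr (\<gamma> * ((u - r) / (u + a)))"
            by (rule convergence_rate[OF ctx order_trans[OF M_le] c_def[THEN fun_cong] x \<alpha> a_s \<delta> nonneg(5)
                small x_le parameter[unfolded q_def] r M_def])
          also have "\<dots> \<le> C5 M * \<delta> powr (\<gamma> * ((u - r) / (u + a)))"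
          proof (rule mult_right_mono)
            have "5 * (1 + c M) * (1 + G M + 2 * M * (1 + c M)) * 1 \<le> C5 M"
              unfolding C5_def using nonneg by (intro mult_left_mono) simp_all
            then show "5 * (1 + c M) * (1 + G M + 2 * M * (1 + c M)) \<le> C5 M"
              by simp
          qed simp
          finally show ?thesis .
        next
          case False
          \<comment> \<open>All orders collapse to \<open>- a\<close>, so the exponent is zero and
            only a bounded error is claimed, which stability alone provides.\<close>
          then have eq: "s = - a" "u = - a" "r = - a"
            using assms(6-8) r by linarith+
          have "(5 * \<delta>) powr \<gamma> \<le> (1 + 5 * \<bar>\<delta>max\<bar>) powr \<gamma>"
            using \<delta> \<delta>max assms(4) by (intro powr_mono2) linarith+
          also have "\<dots> \<le> (1 + 5 * \<bar>\<delta>max\<bar>) powr 1"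
            using assms(5) by (intro powr_mono) simp_all
          finally have D: "(5 * \<delta>) powr \<gamma> \<le> 1 + 5 * \<bar>\<delta>max\<bar>"
            by simp
          have "c M \<le> 5 * (1 + c M) * 1"
            using nonneg(4) by simp
          also have "\<dots> \<le> 5 * (1 + c M) * (1 + G M + 2 * M * (1 + c M))"
            using nonneg by (intro mult_left_mono) simp_all
          finally have c: "c M \<le> 5 * (1 + c M) * (1 + G M + 2 * M * (1 + c M))" .
          have "scale_norm DL L (- a) (x - xdag) \<le> c M * (5 * \<delta>) powr \<gamma>"
            by (rule weak_error_bound[OF ctx order_trans[OF M_le] c_def[THEN fun_cong] x \<alpha> x_le err])
          also have "\<dots> \<le> C5 M"
            unfolding C5_def using order_trans[OF nonneg(4) c] by (intro mult_mono c D) simp_all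
          finally show ?thesis
            using \<delta> unfolding eq by simp
        qed
      qed
      then show ?thesis
        using in_scale[OF order.refl r(2)] by simp
    qed
    then show "norm (F (xs (stopping_index F \<delta> yd xs)) - yd) \<le> 4 * \<delta> \<and>
      (\<forall>x \<in> approx_minimizers DL L s DF F \<delta> (reg_param (stopping_index F \<delta> yd xs)) yd.
         norm (F x - yd) \<le> 4 * \<delta> \<longrightarrow>
         (\<forall>r. - a \<le> r \<longrightarrow> r \<le> s \<longrightarrow>
            x - xdag \<in> scale_space DL L r \<and>
            scale_norm DL L r (x - xdag)
              \<le> C5 (scale_norm DL L u xdag) * \<delta> powr (\<gamma> * ((u - r) / (u + a)))))"
      using stop by (simp add: N_def \<alpha>_def M_def)
  qed
qed

end
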